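(* There is an algorithm that, given an $n$-vertex graph $G$ with a tree decomposition of width $\mathrm{tw}(G)$ and a point $(a,b)$ with $(a-1)(b-1)=2$, computes $T(G;a,b)$ in time $2^{\mathrm{tw}(G)}n^{O(1)}$.
   Context: For $G=(V,E)$ (parallel edges allowed) and $A\subseteq E$, $k(A)$ is the number of components of $(V,A)$; the Tutte polynomial is $T(G;x,y)=\sum_{A\subseteq E}(x-1)^{k(A)-k(E)}(y-1)^{k(A)+|A|-|V|}$. Arithmetic operations on numbers are assumed to take constant time (word RAM).
   Formalization: The time bound is C(2^tw n^c + |x|^c), with |x| the length of the input (graph and decomposition), since parallel edges and decomposition nodes are not bounded in n; for |x| = n^O(1) it is 2^tw n^O(1). Words have O(tw + log|x|) bits. *)

theory Defs
  imports Complex_Main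
begin

section \<open>Multigraphs and the Tutte polynomial\<close>

text \<open>
  The vertices are \<open>0, \<dots>, nverts G - 1\<close> and the edges are the positions of the list \<open>ends G\<close>,
  so that parallel edges are distinct edges.  Relations on vertices stand for undirected edge sets:
  the orientation of a pair carries no meaning.
\<close>

record mgraph =
  nverts :: nat
  ends :: "(nat \<times> nat) list"

definition verts :: "mgraph \<Rightarrow> nat set" where
  "verts G = {..<nverts G}"

definition edges :: "mgraph \<Rightarrow> nat set" where
  "edges G = {..<length (ends G)}"

definition wf_mgraph :: "mgraph \<Rightarrow> bool" where
  "wf_mgraph G \<longleftrightarrow> set (ends G) \<subseteq> verts G \<times> verts G"

definition adj_on :: "'v set \<Rightarrow> ('v \<times> 'v) set \<Rightarrow> ('v \<times> 'v) set" where
  "adj_on S F = (F \<union> F\<inverse>) \<inter> S \<times> S"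

definition same_comp :: "'v set \<Rightarrow> ('v \<times> 'v) set \<Rightarrow> ('v \<times> 'v) set" where
  "same_comp S F = (adj_on S F)\<^sup>* \<inter> S \<times> S"

definition num_comps :: "mgraph \<Rightarrow> nat set \<Rightarrow> nat" where
  "num_comps G A = card (verts G // same_comp (verts G) ((!) (ends G) ` A))"

text \<open>
  Both exponents are nonnegative, because \<open>k(E) \<le> k(A)\<close> and \<open>|V| \<le> k(A) + |A|\<close> for every
  \<open>A \<subseteq> E\<close>; the truncated subtraction of natural numbers is therefore the ordinary one.
\<close>

definition tutte :: "mgraph \<Rightarrow> 'a::comm_ring_1 \<Rightarrow> 'a \<Rightarrow> 'a" where
  "tutte G x y = (\<Sum>A\<in>Pow (edges G).
     (x - 1) ^ (num_comps G A - num_comps G (edges G)) *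
     (y - 1) ^ (num_comps G A + card A - card (verts G)))"


section \<open>Tree decompositions\<close>

definition connected_on :: "'v set \<Rightarrow> ('v \<times> 'v) set \<Rightarrow> bool" where
  "connected_on S F \<longleftrightarrow> (\<forall>u\<in>S. \<forall>v\<in>S. (u, v) \<in> same_comp S F)"

definition is_cycle :: "'v set \<Rightarrow> ('v \<times> 'v) set \<Rightarrow> 'v list \<Rightarrow> bool" where
  "is_cycle S F p \<longleftrightarrow> 3 \<le> length p \<and> distinct p \<and>
     (\<forall>i < length p. (p ! i, p ! (Suc i mod length p)) \<in> adj_on S F)"

definition is_tree :: "'v set \<Rightarrow> ('v \<times> 'v) set \<Rightarrow> bool" where
  "is_tree S F \<longleftrightarrow> finite S \<and> S \<noteq> {} \<and> F \<subseteq> S \<times> S \<and> irrefl F \<and>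
     connected_on S F \<and> (\<nexists>p. is_cycle S F p)"

definition tree_decomposition ::
  "mgraph \<Rightarrow> nat \<Rightarrow> (nat \<times> nat) set \<Rightarrow> (nat \<Rightarrow> nat set) \<Rightarrow> bool" where
  "tree_decomposition G N F X \<longleftrightarrow>
     is_tree {..<N} F \<and>
     (\<Union>t<N. X t) = verts G \<and>
     (\<forall>(u, v) \<in> set (ends G). \<exists>t<N. u \<in> X t \<and> v \<in> X t) \<and>
     (\<forall>v \<in> verts G. connected_on {t. t < N \<and> v \<in> X t} F)"

definition width :: "nat \<Rightarrow> (nat \<Rightarrow> nat set) \<Rightarrow> nat" where
  "width N X = Max ((\<lambda>t. card (X t)) ` {..<N}) - 1"

definition treewidth :: "mgraph \<Rightarrow> nat" where
  "treewidth G = (LEAST w. \<exists>N F X. tree_decomposition G N F X \<and> width N X = w)"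


section \<open>A word RAM with unit-cost arithmetic on numbers\<close>

text \<open>
  Programs are structured and two-sorted.  Words are natural numbers below \<open>2 ^ W\<close>; they serve as
  counters and as array indices.  Numbers are elements of a field.  A program consists of finitely
  many commands and does not depend on the field, on \<open>W\<close>, or on the input.  Every operator,
  constant, register access, array access, assignment and test costs one unit of time.
\<close>

datatype wop = WAdd | WSub | WMul | WDiv | WMod

datatype wexp = WConst nat | WReg nat | WLoad nat wexp | WOp wop wexp wexp

datatype nop = NAdd | NSub | NMul | NDiv

datatype nexp = NZero | NOne | NReg nat | NLoad nat wexp | NOp nop nexp nexp

datatype bexp = WLess wexp wexp | WEq wexp wexp | NEq nexp nexp | BNot bexp | BAnd bexp bexp

datatype com =
    Skip
  | WSet nat wexp
  | WStore nat wexp wexp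
  | NSet nat nexp
  | NStore nat wexp nexp
  | Seq com com
  | Cond bexp com com
  | While bexp com

text \<open>In \<open>warr s k i\<close> and \<open>narr s k i\<close>, \<open>k\<close> names an array and \<open>i\<close> is an index into it.\<close>

record 'a state =
  wreg :: "nat \<Rightarrow> nat"
  warr :: "nat \<Rightarrow> nat \<Rightarrow> nat"
  nreg :: "nat \<Rightarrow> 'a"
  narr :: "nat \<Rightarrow> nat \<Rightarrow> 'a"

fun wop_val :: "nat \<Rightarrow> wop \<Rightarrow> nat \<Rightarrow> nat \<Rightarrow> nat" where
  "wop_val W WAdd x y = (x + y) mod 2 ^ W"
| "wop_val W WSub x y = x - y"
| "wop_val W WMul x y = (x * y) mod 2 ^ W"
| "wop_val W WDiv x y = x div y"
| "wop_val W WMod x y = x mod y"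

fun wval :: "nat \<Rightarrow> 'a state \<Rightarrow> wexp \<Rightarrow> nat" where
  "wval W s (WConst k) = k mod 2 ^ W"
| "wval W s (WReg r) = wreg s r"
| "wval W s (WLoad k e) = warr s k (wval W s e)"
| "wval W s (WOp f e1 e2) = wop_val W f (wval W s e1) (wval W s e2)"

fun nop_val :: "nop \<Rightarrow> 'a::field \<Rightarrow> 'a \<Rightarrow> 'a" where
  "nop_val NAdd x y = x + y"
| "nop_val NSub x y = x - y"
| "nop_val NMul x y = x * y"
| "nop_val NDiv x y = x / y"

fun nval :: "nat \<Rightarrow> 'a::field state \<Rightarrow> nexp \<Rightarrow> 'a" where
  "nval W s NZero = 0"
| "nval W s NOne = 1"
| "nval W s (NReg r) = nreg s r"
| "nval W s (NLoad k e) = narr s k (wval W s e)"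
| "nval W s (NOp f e1 e2) = nop_val f (nval W s e1) (nval W s e2)"

fun bval :: "nat \<Rightarrow> 'a::field state \<Rightarrow> bexp \<Rightarrow> bool" where
  "bval W s (WLess e1 e2) \<longleftrightarrow> wval W s e1 < wval W s e2"
| "bval W s (WEq e1 e2) \<longleftrightarrow> wval W s e1 = wval W s e2"
| "bval W s (NEq e1 e2) \<longleftrightarrow> nval W s e1 = nval W s e2"
| "bval W s (BNot b) \<longleftrightarrow> \<not> bval W s b"
| "bval W s (BAnd b1 b2) \<longleftrightarrow> bval W s b1 \<and> bval W s b2"

fun wcost :: "wexp \<Rightarrow> nat" where
  "wcost (WConst k) = 1"
| "wcost (WReg r) = 1"
| "wcost (WLoad k e) = 1 + wcost e"
| "wcost (WOp f e1 e2) = 1 + wcost e1 + wcost e2"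

fun ncost :: "nexp \<Rightarrow> nat" where
  "ncost NZero = 1"
| "ncost NOne = 1"
| "ncost (NReg r) = 1"
| "ncost (NLoad k e) = 1 + wcost e"
| "ncost (NOp f e1 e2) = 1 + ncost e1 + ncost e2"

fun bcost :: "bexp \<Rightarrow> nat" where
  "bcost (WLess e1 e2) = 1 + wcost e1 + wcost e2"
| "bcost (WEq e1 e2) = 1 + wcost e1 + wcost e2"
| "bcost (NEq e1 e2) = 1 + ncost e1 + ncost e2"
| "bcost (BNot b) = 1 + bcost b"
| "bcost (BAnd b1 b2) = 1 + bcost b1 + bcost b2"

text \<open>
  \<open>exec W c s t s'\<close>: on a machine with \<open>W\<close>-bit words, \<open>c\<close> started in \<open>s\<close> halts in \<open>s'\<close> after
  \<open>t\<close> units of time.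
\<close>

inductive exec ::
  "nat \<Rightarrow> com \<Rightarrow> 'a::field state \<Rightarrow> nat \<Rightarrow> 'a state \<Rightarrow> bool" for W :: nat where
  Skip: "exec W Skip s 1 s"
| WSet: "exec W (WSet r e) s (1 + wcost e) (s\<lparr>wreg := (wreg s)(r := wval W s e)\<rparr>)"
| WStore: "exec W (WStore k i e) s (1 + wcost i + wcost e)
    (s\<lparr>warr := (warr s)(k := (warr s k)(wval W s i := wval W s e))\<rparr>)"
| NSet: "exec W (NSet r e) s (1 + ncost e) (s\<lparr>nreg := (nreg s)(r := nval W s e)\<rparr>)"
| NStore: "exec W (NStore k i e) s (1 + wcost i + ncost e)
    (s\<lparr>narr := (narr s)(k := (narr s k)(wval W s i := nval W s e))\<rparr>)"
| Seq: "exec W c1 s t1 s' \<Longrightarrow> exec W c2 s' t2 s'' \<Longrightarrow> exec W (Seq c1 c2) s (t1 + t2) s''"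
| CondTrue: "bval W s b \<Longrightarrow> exec W c1 s t s' \<Longrightarrow> exec W (Cond b c1 c2) s (1 + bcost b + t) s'"
| CondFalse: "\<not> bval W s b \<Longrightarrow> exec W c2 s t s' \<Longrightarrow> exec W (Cond b c1 c2) s (1 + bcost b + t) s'"
| WhileFalse: "\<not> bval W s b \<Longrightarrow> exec W (While b c) s (1 + bcost b) s"
| WhileTrue: "bval W s b \<Longrightarrow> exec W c s t1 s' \<Longrightarrow> exec W (While b c) s' t2 s'' \<Longrightarrow>
    exec W (While b c) s (1 + bcost b + t1 + t2) s''"

inductive_cases exec_SkipE: "exec W Skip s t s'"
inductive_cases exec_WSetE: "exec W (WSet r e) s t s'"
inductive_cases exec_WStoreE: "exec W (WStore k i e) s t s'"
inductive_cases exec_NSetE: "exec W (NSet r e) s t s'"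
inductive_cases exec_NStoreE: "exec W (NStore k i e) s t s'"
inductive_cases exec_SeqE: "exec W (Seq c1 c2) s t s'"
inductive_cases exec_CondE: "exec W (Cond b c1 c2) s t s'"
inductive_cases exec_WhileE: "exec W (While b c) s t s'"

lemma exec_deterministic:
  assumes "exec W c s t s'" and "exec W c s u s''"
  shows "t = u \<and> s' = s''"
  using assms
proof (induction arbitrary: u s'' rule: exec.induct)
  case (Skip s)
  then show ?case by (rule exec_SkipE) simp
next
  case (WSet r e s)
  then show ?case by (rule exec_WSetE) simp
next
  case (WStore k i e s)
  then show ?case by (rule exec_WStoreE) simp
next
  case (NSet r e s)
  then show ?case by (rule exec_NSetE) simp
next
  case (NStore k i e s)
  then show ?case by (rule exec_NStoreE) simp
next
  case (Seq c1 s t1 s1 c2 t2 s2)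
  from Seq.prems show ?case
  proof (rule exec_SeqE)
    fix u1 r u2
    assume u: "u = u1 + u2" and r: "exec W c1 s u1 r" "exec W c2 r u2 s''"
    from Seq.IH(1)[OF r(1)] have "t1 = u1" "s1 = r" by simp_all
    with Seq.IH(2)[of u2 s''] r(2) u show ?thesis by simp
  qed
next
  case (CondTrue s b c1 t s1 c2)
  from CondTrue.prems CondTrue.hyps obtain u' where "u = 1 + bcost b + u'" and "exec W c1 s u' s''"
    by (auto elim: exec_CondE)
  with CondTrue.IH[of u' s''] show ?case by simp
next
  case (CondFalse s b c2 t s1 c1)
  from CondFalse.prems CondFalse.hyps obtain u' where "u = 1 + bcost b + u'" and "exec W c2 s u' s''"
    by (auto elim: exec_CondE)
  with CondFalse.IH[of u' s''] show ?case by simp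
next
  case (WhileFalse s b c)
  from WhileFalse.prems show ?case by (rule exec_WhileE) (use WhileFalse.hyps in auto)
next
  case (WhileTrue s b c t1 s1 t2 s2)
  from WhileTrue.prems show ?case
  proof (rule exec_WhileE)
    assume "\<not> bval W s b"
    with WhileTrue.hyps show ?thesis by simp
  next
    fix u1 r u2
    assume u: "u = Suc (bcost b + u1 + u2)"
      and r: "exec W c s u1 r" "exec W (While b c) r u2 s''"
    from WhileTrue.IH(1)[OF r(1)] have "t1 = u1" "s1 = r" by simp_all
    with WhileTrue.IH(2)[of u2 s''] r(2) u show ?thesis by simp
  qed
qed


section \<open>Inputs\<close>

text \<open>
  A tree decomposition is given by the list \<open>F\<close> of the edges of its tree and the list \<open>B\<close> of its
  bags, each bag being a list of vertices without repetitions; the nodes of the tree are the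
  positions of \<open>B\<close>.
\<close>

definition bag :: "nat list list \<Rightarrow> nat \<Rightarrow> nat set" where
  "bag B t = set (B ! t)"

definition encodes_tree_decomposition ::
  "mgraph \<Rightarrow> (nat \<times> nat) list \<Rightarrow> nat list list \<Rightarrow> bool" where
  "encodes_tree_decomposition G F B \<longleftrightarrow>
     (\<forall>xs \<in> set B. distinct xs) \<and> tree_decomposition G (length B) (set F) (bag B)"

text \<open>
  Neither the number of (possibly parallel) edges nor the number of nodes of the decomposition is
  bounded in terms of the number of vertices, so the length of the input is a parameter of its own.
\<close>

definition input_size :: "mgraph \<Rightarrow> (nat \<times> nat) list \<Rightarrow> nat list list \<Rightarrow> nat" where
  "input_size G F B =
     nverts G + length (ends G) + length F + length B + length (concat B)"

definition array_of :: "'b::zero list \<Rightarrow> nat \<Rightarrow> 'b" where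
  "array_of xs i = (if i < length xs then xs ! i else 0)"

text \<open>The bags are stored one after the other in array 5; array 4 holds their sizes.\<close>

definition init_state ::
  "mgraph \<Rightarrow> (nat \<times> nat) list \<Rightarrow> nat list list \<Rightarrow> 'a::field \<Rightarrow> 'a \<Rightarrow> 'a state" where
  "init_state G F B a b = \<lparr>
     wreg = array_of [nverts G, length (ends G), length F, length B],
     warr = (\<lambda>k. array_of (if k < 6
        then [map fst (ends G), map snd (ends G), map fst F, map snd F, map length B, concat B] ! k
        else [])),
     nreg = array_of [a, b],
     narr = (\<lambda>_ _. 0)\<rparr>"

definition result :: "'a state \<Rightarrow> 'a" where
  "result s = nreg s 0"

end

theory Submission
  imports Defs
begin

text \<open>
  On the curve \<open>(a - 1) (b - 1) = 2\<close> the Tutte polynomial is, up to the factor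
  \<open>(a - 1) ^ k(E) * (b - 1) ^ |V|\<close>, the Ising partition function: the sum over all vertex sets \<open>S\<close>
  of \<open>b\<close> to the number of edges not cut by \<open>S\<close>, because \<open>2 ^ k(A)\<close> counts the sets \<open>S\<close> that cut no
  edge of \<open>A\<close>.  The partition function is computed by eliminating one vertex at a time.
  If \<open>R\<close> is the set of remaining vertices, some \<open>v \<in> R\<close> has a bag containing all of \<open>R\<close> that shares
  a bag with \<open>v\<close>; summing out the side of \<open>v\<close> leaves a factor that depends on the
  at most \<open>tw\<close> other vertices of \<open>R\<close> in that bag.  Eliminating vertices rather than traversing the tree,
  and merging parallel edges beforehand, keeps the exponential cost at \<open>2 ^ tw\<close> times a polynomial
  in the number of vertices alone.
\<close>

section \<open>Weakest preconditions with running time\<close>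

text \<open>The time bound keeps \<open>2 ^ tw\<close> times a power of the number of vertices apart
  from a power of the input length, although edges and nodes may outnumber the vertices arbitrarily.
  So exponential work occurs only in the tables, one per vertex, while edges and bags are merely
  scanned in polynomial time. Eliminability compares bags restricted to the remaining vertices,
  hence the decomposition is never rebuilt; its tree guarantees that the search succeeds. A pending
  factor behaves like a hyperedge: the invariant keeps its scope inside some bag, so the argument
  that confines the neighbours of \<open>v\<close> to one bag also confines the scopes absorbed with
  \<open>v\<close>, and the new scope lies in a bag again. In characteristic 0 the equation of the
  curve makes \<open>a - 1\<close> and \<open>b - 1\<close> nonzero, so the factor between the two
  polynomials can be divided out at the end. The assumed lower bound on \<open>2 ^ W\<close> exceeds
  every array index and every place value that is formed, so no word operation wraps around.\<close>

definition wp :: "nat \<Rightarrow> com \<Rightarrow> 'a::field state \<Rightarrow> (nat \<Rightarrow> 'a state \<Rightarrow> bool) \<Rightarrow> bool" where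
  "wp W c s Q \<longleftrightarrow> (\<exists>t s'. exec W c s t s' \<and> Q t s')"

text \<open>Determinism of the machine turns the existential in \<open>wp\<close> into an equation.
  The rules for loop-free code thereby become rewrite rules, and symbolic execution is
  simplification.\<close>

lemma wp_eq: "exec W c s t s' \<Longrightarrow> wp W c s Q \<longleftrightarrow> Q t s'"
  unfolding wp_def using exec_deterministic by blast

lemma wp_atomic [simp]:
  "wp W Skip s Q \<longleftrightarrow> Q 1 s"
  "wp W (WSet r e) s Q \<longleftrightarrow> Q (1 + wcost e) (s\<lparr>wreg := (wreg s)(r := wval W s e)\<rparr>)"
  "wp W (WStore k i e) s Q \<longleftrightarrow> Q (1 + wcost i + wcost e)
    (s\<lparr>warr := (warr s)(k := (warr s k)(wval W s i := wval W s e))\<rparr>)"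
  "wp W (NSet q x) s Q \<longleftrightarrow> Q (1 + ncost x) (s\<lparr>nreg := (nreg s)(q := nval W s x)\<rparr>)"
  "wp W (NStore k i x) s Q \<longleftrightarrow> Q (1 + wcost i + ncost x)
    (s\<lparr>narr := (narr s)(k := (narr s k)(wval W s i := nval W s x))\<rparr>)"
  by (rule wp_eq, rule exec.intros)+

lemma wp_Seq [simp]:
  "wp W (Seq c1 c2) s Q \<longleftrightarrow> wp W c1 s (\<lambda>t1 s1. wp W c2 s1 (\<lambda>t2. Q (t1 + t2)))"
proof
  assume "wp W (Seq c1 c2) s Q"
  then show "wp W c1 s (\<lambda>t1 s1. wp W c2 s1 (\<lambda>t2. Q (t1 + t2)))"
    unfolding wp_def by (metis exec_SeqE)
next
  assume "wp W c1 s (\<lambda>t1 s1. wp W c2 s1 (\<lambda>t2. Q (t1 + t2)))"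
  then show "wp W (Seq c1 c2) s Q"
    unfolding wp_def by (metis exec.Seq)
qed

lemma wp_Cond [simp]:
  "wp W (Cond b c1 c2) s Q \<longleftrightarrow>
    (if bval W s b then wp W c1 s (\<lambda>t. Q (1 + bcost b + t))
     else wp W c2 s (\<lambda>t. Q (1 + bcost b + t)))" (is "_ \<longleftrightarrow> ?R")
proof
  assume "wp W (Cond b c1 c2) s Q"
  then show ?R unfolding wp_def by (auto elim!: exec_CondE)
next
  assume ?R
  then show "wp W (Cond b c1 c2) s Q"
    unfolding wp_def by (metis exec.CondTrue exec.CondFalse)
qed

lemma wp_mono:
  assumes "wp W c s P" and "\<And>t s'. P t s' \<Longrightarrow> Q t s'"
  shows "wp W c s Q"
  using assms unfolding wp_def by blast

fun wregs_of :: "com \<Rightarrow> nat set" where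
  "wregs_of (WSet r e) = {r}"
| "wregs_of (Seq c1 c2) = wregs_of c1 \<union> wregs_of c2"
| "wregs_of (Cond b c1 c2) = wregs_of c1 \<union> wregs_of c2"
| "wregs_of (While b c) = wregs_of c"
| "wregs_of _ = {}"

fun warrs_of :: "com \<Rightarrow> nat set" where
  "warrs_of (WStore k i e) = {k}"
| "warrs_of (Seq c1 c2) = warrs_of c1 \<union> warrs_of c2"
| "warrs_of (Cond b c1 c2) = warrs_of c1 \<union> warrs_of c2"
| "warrs_of (While b c) = warrs_of c"
| "warrs_of _ = {}"

fun nregs_of :: "com \<Rightarrow> nat set" where
  "nregs_of (NSet r e) = {r}"
| "nregs_of (Seq c1 c2) = nregs_of c1 \<union> nregs_of c2"
| "nregs_of (Cond b c1 c2) = nregs_of c1 \<union> nregs_of c2"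
| "nregs_of (While b c) = nregs_of c"
| "nregs_of _ = {}"

fun narrs_of :: "com \<Rightarrow> nat set" where
  "narrs_of (NStore k i e) = {k}"
| "narrs_of (Seq c1 c2) = narrs_of c1 \<union> narrs_of c2"
| "narrs_of (Cond b c1 c2) = narrs_of c1 \<union> narrs_of c2"
| "narrs_of (While b c) = narrs_of c"
| "narrs_of _ = {}"

text \<open>The write sets are syntactic and hence over-approximate. They free loop invariants from
  everything that a body cannot touch.\<close>

definition frame :: "com \<Rightarrow> 'a state \<Rightarrow> 'a state \<Rightarrow> bool" where
  "frame c s s' \<longleftrightarrow>
    (\<forall>r. r \<notin> wregs_of c \<longrightarrow> wreg s' r = wreg s r) \<and>
    (\<forall>k. k \<notin> warrs_of c \<longrightarrow> warr s' k = warr s k) \<and>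
    (\<forall>r. r \<notin> nregs_of c \<longrightarrow> nreg s' r = nreg s r) \<and>
    (\<forall>k. k \<notin> narrs_of c \<longrightarrow> narr s' k = narr s k)"

lemma exec_frame: "exec W c s t s' \<Longrightarrow> frame c s s'"
  by (induction rule: exec.induct) (auto simp: frame_def)

lemma wp_frame:
  assumes "wp W c s P" and "\<And>t s'. P t s' \<Longrightarrow> frame c s s' \<Longrightarrow> Q t s'"
  shows "wp W c s Q"
  using assms exec_frame unfolding wp_def by blast

text \<open>The bound \<open>e\<close> is evaluated anew before every iteration; this is why
  \<open>wp_For\<close> asks for its value in all intermediate states.\<close>

definition For :: "nat \<Rightarrow> wexp \<Rightarrow> com \<Rightarrow> com" where
  "For r e c = Seq (WSet r (WConst 0))
     (While (WLess (WReg r) e) (Seq c (WSet r (WOp WAdd (WReg r) (WConst 1)))))"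

abbreviation If_then :: "bexp \<Rightarrow> com \<Rightarrow> com" where
  "If_then b c \<equiv> Cond b c Skip"

lemma mods_For [simp]:
  "wregs_of (For r e c) = insert r (wregs_of c)"
  "warrs_of (For r e c) = warrs_of c"
  "nregs_of (For r e c) = nregs_of c"
  "narrs_of (For r e c) = narrs_of c"
  by (auto simp: For_def)

text \<open>The costs are exact up to \<open>T\<close>: a test costs \<open>wcost e + 3\<close>, the
  increment 4, the initialisation 2. This gives \<open>T + wcost e + 7\<close> per iteration and
  \<open>wcost e + 5\<close> for the initialisation with the last, failing test. The condition
  \<open>n < 2 ^ W\<close> keeps the counter from wrapping around.\<close>

lemma wp_For:
  fixes s :: "'a::field state"
  assumes n: "n < 2 ^ W"
    and r: "r \<notin> wregs_of c"
    and bound: "\<And>i s'. i \<le> n \<Longrightarrow> I i s' \<Longrightarrow> wreg s' r = i \<Longrightarrow> frame (For r e c) s s' \<Longrightarrow> wval W s' e = n"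
    and init: "I 0 (s\<lparr>wreg := (wreg s)(r := 0)\<rparr>)"
    and step: "\<And>i s'. i < n \<Longrightarrow> I i s' \<Longrightarrow> wreg s' r = i \<Longrightarrow> frame (For r e c) s s' \<Longrightarrow>
      wp W c s' (\<lambda>t s''. t \<le> T \<and> (frame c s' s'' \<longrightarrow> I (Suc i) (s''\<lparr>wreg := (wreg s'')(r := Suc i)\<rparr>)))"
    and post: "\<And>t s'. t \<le> n * (T + wcost e + 7) + (wcost e + 5) \<Longrightarrow> I n s' \<Longrightarrow> wreg s' r = n \<Longrightarrow>
      frame (For r e c) s s' \<Longrightarrow> Q t s'"
  shows "wp W (For r e c) s Q"
proof -
  let ?b = "WLess (WReg r) e"
  let ?c = "Seq c (WSet r (WOp WAdd (WReg r) (WConst 1)))"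
  have loop: "\<exists>t s''. exec W (While ?b ?c) s' t s'' \<and> t \<le> (n - i) * (T + wcost e + 7) + (wcost e + 3) \<and>
      I n s'' \<and> wreg s'' r = n \<and> frame (For r e c) s s''"
    if "i \<le> n" "I i s'" "wreg s' r = i" "frame (For r e c) s s'" for i s'
    using that
  proof (induction "n - i" arbitrary: i s')
    case 0
    then have "\<not> bval W s' ?b" using bound[of i s'] by simp
    then have "exec W (While ?b ?c) s' (1 + bcost ?b) s'" by (rule exec.WhileFalse)
    moreover have "i = n" using 0 by simp
    ultimately show ?case using 0 by (intro exI[of _ "1 + bcost ?b"] exI[of _ s']) auto
  next
    case (Suc k)
    then have i: "i < n" by simp
    then have W: "Suc i < 2 ^ W" using n by simp
    then have W1: "0 < W" by (cases W) auto
    have b: "bval W s' ?b" using bound[of i s'] Suc.prems i by simp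
    obtain t1 s1 where e1: "exec W c s' t1 s1" "t1 \<le> T"
      "frame c s' s1 \<longrightarrow> I (Suc i) (s1\<lparr>wreg := (wreg s1)(r := Suc i)\<rparr>)"
      using step[OF i Suc.prems(2-4)] unfolding wp_def by blast
    have fr: "frame c s' s1" using exec_frame[OF e1(1)] .
    define s2 where "s2 = s1\<lparr>wreg := (wreg s1)(r := Suc i)\<rparr>"
    have rr: "wreg s1 r = i" using fr r Suc.prems by (simp add: frame_def)
    then have "wval W s1 (WOp WAdd (WReg r) (WConst 1)) = Suc i" using W W1 by simp
    then have e2: "exec W (WSet r (WOp WAdd (WReg r) (WConst 1))) s1 4 s2"
      using exec.WSet[of W r "WOp WAdd (WReg r) (WConst 1)" s1] by (simp add: s2_def eval_nat_numeral)
    have e: "exec W ?c s' (t1 + 4) s2" by (rule exec.Seq[OF e1(1) e2])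
    have "frame (For r e c) s s2" using fr Suc.prems by (auto simp: frame_def s2_def)
    then obtain t s3 where w: "exec W (While ?b ?c) s2 t s3"
      "t \<le> (n - Suc i) * (T + wcost e + 7) + (wcost e + 3)" "I n s3" "wreg s3 r = n" "frame (For r e c) s s3"
      using Suc.hyps(1)[of "Suc i" s2] Suc.hyps(2) i e1(3) fr by (fastforce simp: s2_def)
    have "exec W (While ?b ?c) s' (1 + bcost ?b + (t1 + 4) + t) s3"
      by (rule exec.WhileTrue[OF b e w(1)])
    moreover have "n - i = Suc (n - Suc i)" using i by simp
    then have "1 + bcost ?b + (t1 + 4) + t \<le> (n - i) * (T + wcost e + 7) + (wcost e + 3)"
      using w(2) e1(2) by simp
    ultimately show ?case using w by blast
  qed
  define s0 where "s0 = s\<lparr>wreg := (wreg s)(r := 0)\<rparr>"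
  have e0: "exec W (WSet r (WConst 0)) s 2 s0"
    using exec.WSet[of W r "WConst 0" s] by (simp add: s0_def eval_nat_numeral)
  obtain t s' where t: "exec W (While ?b ?c) s0 t s'" "t \<le> n * (T + wcost e + 7) + (wcost e + 3)"
      "I n s'" "wreg s' r = n" "frame (For r e c) s s'"
    using loop[of 0 s0] init by (auto simp: s0_def frame_def)
  have "exec W (For r e c) s (2 + t) s'" unfolding For_def by (rule exec.Seq[OF e0 t(1)])
  moreover have "Q (2 + t) s'" using t by (intro post) auto
  ultimately show ?thesis unfolding wp_def by blast
qed

section \<open>Eliminable vertices of a tree decomposition\<close>

lemma adj_on_sym: "(x, y) \<in> adj_on S F \<longleftrightarrow> (y, x) \<in> adj_on S F"
  by (auto simp: adj_on_def)

lemma adj_on_mono: "S \<subseteq> T \<Longrightarrow> adj_on S F \<subseteq> adj_on T F"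
  by (auto simp: adj_on_def)

lemma is_cycle_mono: "S \<subseteq> T \<Longrightarrow> is_cycle S F p \<Longrightarrow> is_cycle T F p"
  using adj_on_mono[of S T F] by (auto simp: is_cycle_def)

text \<open>Sending \<open>l\<close> to its only possible neighbour \<open>p\<close> maps every walk
  in \<open>S\<close> to a walk avoiding \<open>l\<close>, because steps at \<open>l\<close>
  collapse. \<open>l\<close> need not belong to \<open>S\<close>, so the lemma serves both the tree
  and the subtrees belonging to single vertices.\<close>

lemma connected_on_remove_leaf:
  assumes conn: "connected_on S F" and leaf: "\<And>q. (l, q) \<in> adj_on S F \<Longrightarrow> q = p"
  shows "connected_on (S - {l}) F"
  unfolding connected_on_def
proof (intro ballI)
  fix u v assume uv: "u \<in> S - {l}" "v \<in> S - {l}"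
  define f where "f x = (if x = l then p else x)" for x
  have step: "(f x, f y) \<in> (adj_on (S - {l}) F)\<^sup>*" if "(x, y) \<in> adj_on S F" for x y
  proof (cases "x = l \<or> y = l")
    case True
    then have "f x = f y" using leaf that adj_on_sym by (metis f_def)
    then show ?thesis by simp
  next
    case False
    then show ?thesis using that by (auto simp: f_def adj_on_def)
  qed
  have "(u, v) \<in> (adj_on S F)\<^sup>*" using conn uv by (auto simp: connected_on_def same_comp_def)
  then have "(f u, f v) \<in> (adj_on (S - {l}) F)\<^sup>*"
    by (induction rule: rtrancl_induct) (auto intro: rtrancl_trans step)
  then show "(u, v) \<in> same_comp (S - {l}) F" using uv by (auto simp: f_def same_comp_def)
qed

text \<open>The first vertex of a longest path is a leaf: a second neighbour off the path would
  prolong the path, and one on the path would close a cycle.\<close>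

lemma exists_leaf:
  assumes fin: "finite S" and irr: "irrefl F" and conn: "connected_on S F"
    and acyc: "\<nexists>p. is_cycle S F p" and card: "u \<in> S" "v \<in> S" "u \<noteq> v"
  obtains l p where "l \<in> S" "p \<in> S" "p \<noteq> l" "\<And>q. (l, q) \<in> adj_on S F \<Longrightarrow> q = p"
proof -
  define path where "path xs \<longleftrightarrow> distinct xs \<and> set xs \<subseteq> S \<and>
    (\<forall>i. Suc i < length xs \<longrightarrow> (xs ! i, xs ! Suc i) \<in> adj_on S F)" for xs
  have "(u, v) \<in> (adj_on S F)\<^sup>*" using conn card by (auto simp: connected_on_def same_comp_def)
  then obtain z where z: "(u, z) \<in> adj_on S F" using card(3) by (auto elim: converse_rtranclE)
  then have "u \<noteq> z" using irr by (auto simp: adj_on_def irrefl_def)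
  with z have p2: "path [u, z]" by (auto simp: path_def adj_on_def)
  have "\<forall>xs. path xs \<longrightarrow> length xs < Suc (card S)"
    by (metis path_def fin card_mono distinct_card less_Suc_eq_le)
  then obtain xs where xs: "path xs" and max: "\<And>ys. path ys \<Longrightarrow> length ys \<le> length xs"
    using ex_has_greatest_nat[of path "[u, z]" length "Suc (card S)"] p2 by blast
  have len: "2 \<le> length xs" using max[OF p2] by simp
  then obtain l p zs where zs: "xs = l # p # zs" by (metis Suc_le_length_iff numeral_2_eq_2)
  then have l_def: "l = xs ! 0" and p_def: "p = xs ! 1" by simp_all
  have lp: "l \<in> S" "p \<in> S" "p \<noteq> l" using xs by (auto simp: path_def zs)
  have "q = p" if q: "(l, q) \<in> adj_on S F" for q
  proof (rule ccontr)
    assume qp: "q \<noteq> p"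
    have qS: "q \<in> S" using q by (auto simp: adj_on_def)
    have ql: "q \<noteq> l" using q irr by (auto simp: adj_on_def irrefl_def)
    show False
    proof (cases "q \<in> set xs")
      case False
      have "path (q # xs)"
        using xs q False qS adj_on_sym[of l q S F] unfolding path_def l_def by (auto simp: nth_Cons split: nat.split)
      then show False using max by fastforce
    next
      case True
      then obtain i where i: "i < length xs" "q = xs ! i" by (auto simp: in_set_conv_nth)
      have "i \<noteq> 0" "i \<noteq> 1" using i ql qp unfolding l_def p_def by metis+
      then have i2: "2 \<le> i" by simp
      have len_take: "length (take (Suc i) xs) = Suc i" using i by simp
      \<comment> \<open>Position 0 is \<open>l\<close> and position 1 is \<open>p\<close>, so
        \<open>2 \<le> i\<close> and the prefix ending in \<open>q\<close> has the three vertices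
        that \<open>is_cycle\<close> demands.\<close>
      have "is_cycle S F (take (Suc i) xs)"
        unfolding is_cycle_def
      proof (intro conjI allI impI)
        fix j assume "j < length (take (Suc i) xs)"
        then have j: "j \<le> i" using i by simp
        show "(take (Suc i) xs ! j, take (Suc i) xs ! (Suc j mod length (take (Suc i) xs))) \<in> adj_on S F"
        proof (cases "j = i")
          case True
          then show ?thesis using i q adj_on_sym[of l q S F] unfolding len_take by (simp add: l_def)
        next
          case False
          then show ?thesis using i j xs unfolding len_take by (simp add: path_def)
        qed
      qed (use i i2 xs in \<open>auto simp: path_def\<close>)
      then show False using acyc by blast
    qed
  qed
  then show ?thesis using that lp by blast
qed

text \<open>A chordal graph has a simplicial vertex, phrased for the bags: if some leaf bag contains a
  vertex of \<open>R\<close> missing from the neighbouring bag, that vertex lies in no other bag; otherwise the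
  leaf is redundant.\<close>

lemma exists_eliminable:
  assumes "finite S" "S \<noteq> {}" "irrefl F" "connected_on S F" "\<nexists>p. is_cycle S F p"
    and "\<And>v. v \<in> R \<Longrightarrow> connected_on {t \<in> S. v \<in> X t} F"
    and "R \<noteq> {}" "R \<subseteq> (\<Union>t\<in>S. X t)"
  shows "\<exists>v\<in>R. \<exists>t\<in>S. v \<in> X t \<and> (\<forall>s\<in>S. v \<in> X s \<longrightarrow> X s \<inter> R \<subseteq> X t)"
  using assms
proof (induction "card S" arbitrary: S rule: less_induct)
  case less
  show ?case
  proof (cases "\<exists>t. S = {t}")
    case True
    then show ?thesis using less.prems by blast
  next
    case False
    then obtain u v where "u \<in> S" "v \<in> S" "u \<noteq> v" using less.prems(2) by blast
    then obtain l p where lp: "l \<in> S" "p \<in> S" "p \<noteq> l" "\<And>q. (l, q) \<in> adj_on S F \<Longrightarrow> q = p"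
      using exists_leaf[OF less.prems(1,3,4,5)] by metis
    have leaf: "(l, q) \<in> adj_on T F \<Longrightarrow> q = p" if "T \<subseteq> S" for q T
      using lp(4) adj_on_mono[OF that] by blast
    show ?thesis
    proof (cases "X l \<inter> R \<subseteq> X p")
      case True
      have "\<exists>v\<in>R. \<exists>t\<in>S - {l}. v \<in> X t \<and> (\<forall>s\<in>S - {l}. v \<in> X s \<longrightarrow> X s \<inter> R \<subseteq> X t)"
      proof (rule less.hyps)
        show "card (S - {l}) < card S" using less.prems(1) lp(1) by (intro card_Diff1_less)
        show "connected_on (S - {l}) F" using connected_on_remove_leaf less.prems(4) lp(4) by metis
        show "\<nexists>p. is_cycle (S - {l}) F p" using less.prems(5) is_cycle_mono[of "S - {l}" S] by blast
        show "connected_on {t \<in> S - {l}. v \<in> X t} F" if "v \<in> R" for v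
        proof -
          have "{t \<in> S - {l}. v \<in> X t} = {t \<in> S. v \<in> X t} - {l}" by auto
          then show ?thesis
            using connected_on_remove_leaf[OF less.prems(6)[OF that]] leaf[of "{t \<in> S. v \<in> X t}"]
            by auto
        qed
        show "R \<subseteq> (\<Union>t\<in>S - {l}. X t)"
        proof
          fix x assume x: "x \<in> R"
          then obtain t where t: "t \<in> S" "x \<in> X t" using less.prems(8) by blast
          show "x \<in> (\<Union>t\<in>S - {l}. X t)"
            using t x True lp(2,3) by (cases "t = l") auto
        qed
      qed (use less.prems lp in auto)
      then obtain v t where vt: "v \<in> R" "t \<in> S - {l}" "v \<in> X t"
        "\<And>s. s \<in> S - {l} \<Longrightarrow> v \<in> X s \<Longrightarrow> X s \<inter> R \<subseteq> X t" by blast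
      \<comment> \<open>The induction hypothesis says nothing about the removed bag. If
        \<open>X l\<close> contains \<open>v\<close>, then so does \<open>X p\<close>, and the
        inclusion for \<open>p\<close> passes on to \<open>l\<close>.\<close>
      have "X s \<inter> R \<subseteq> X t" if "s \<in> S" "v \<in> X s" for s
      proof (cases "s = l")
        case s: True
        then have "v \<in> X p" using that vt True by blast
        then have "X p \<inter> R \<subseteq> X t" using vt lp by blast
        then show ?thesis using s True by blast
      qed (use that vt in blast)
      then show ?thesis using vt by blast
    next
      case False
      then obtain v where v: "v \<in> X l" "v \<in> R" "v \<notin> X p" by blast
      \<comment> \<open>The nodes whose bags contain \<open>v\<close> are connected, and
        \<open>l\<close> has no neighbour but \<open>p\<close>; a second such node would force
        \<open>v\<close> into \<open>X p\<close>.\<close>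
      have "s = l" if s: "s \<in> S" "v \<in> X s" for s
      proof (rule ccontr)
        assume ne: "s \<noteq> l"
        let ?T = "{t \<in> S. v \<in> X t}"
        have "(l, s) \<in> (adj_on ?T F)\<^sup>*"
          using less.prems(6)[OF v(2)] s v lp(1) by (auto simp: connected_on_def same_comp_def)
        then obtain q where q: "(l, q) \<in> adj_on ?T F" using ne by (auto elim: converse_rtranclE)
        then have "q = p" using leaf[of ?T] by auto
        then show False using q v by (auto simp: adj_on_def)
      qed
      then show ?thesis using v lp(1) by blast
    qed
  qed
qed

section \<open>The Tutte polynomial and the Ising partition function\<close>

text \<open>A saturated set is a union of equivalence classes in exactly one way, so
  \<open>Union\<close> is a bijection from the sets of classes.\<close>

lemma card_saturated:
  assumes "finite V" and r: "equiv V r"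
  shows "card {S. S \<subseteq> V \<and> (\<forall>x y. (x, y) \<in> r \<longrightarrow> x \<in> S \<longrightarrow> y \<in> S)} = 2 ^ card (V // r)"
proof -
  have rV: "r \<subseteq> V \<times> V" using r by (rule equiv_type)
  have fin: "finite (V // r)" by (rule finite_quotient[OF assms(1) rV])
  have sub: "C \<subseteq> V" if "C \<in> V // r" for C using in_quotient_imp_subset[OF r that] .
  have dis: "C = C'" if "C \<in> V // r" "C' \<in> V // r" "x \<in> C" "x \<in> C'" for C C' x
    using quotient_disj[OF r that(1,2)] that(3,4) by blast
  have "bij_betw Union (Pow (V // r)) {S. S \<subseteq> V \<and> (\<forall>x y. (x, y) \<in> r \<longrightarrow> x \<in> S \<longrightarrow> y \<in> S)}"
  proof (rule bij_betw_imageI)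
    show "inj_on Union (Pow (V // r))"
    proof (rule inj_onI)
      fix P Q assume PQ: "P \<in> Pow (V // r)" "Q \<in> Pow (V // r)" "\<Union>P = \<Union>Q"
      have *: "C \<in> B" if AB: "A \<in> Pow (V // r)" "B \<in> Pow (V // r)" "\<Union>A = \<Union>B" "C \<in> A" for A B C
      proof -
        obtain x where x: "x \<in> C" using in_quotient_imp_non_empty[OF r, of C] AB by blast
        then obtain C' where "C' \<in> B" "x \<in> C'" using AB by blast
        then show ?thesis using dis[of C C' x] x AB by blast
      qed
      show "P = Q" using *[of P Q] *[of Q P] PQ by blast
    qed
    show "Union ` Pow (V // r) = {S. S \<subseteq> V \<and> (\<forall>x y. (x, y) \<in> r \<longrightarrow> x \<in> S \<longrightarrow> y \<in> S)}"
    proof (intro equalityI subsetI)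
      fix S assume "S \<in> Union ` Pow (V // r)"
      then obtain P where P: "P \<subseteq> V // r" "S = \<Union>P" by blast
      have "y \<in> S" if xy: "(x, y) \<in> r" "x \<in> S" for x y
      proof -
        obtain C where C: "C \<in> P" "x \<in> C" using P xy by blast
        then have "y \<in> C" using in_quotient_imp_closed[OF r _ C(2) xy(1)] P by blast
        then show ?thesis using C P by blast
      qed
      then show "S \<in> {S. S \<subseteq> V \<and> (\<forall>x y. (x, y) \<in> r \<longrightarrow> x \<in> S \<longrightarrow> y \<in> S)}" using P sub by blast
    next
      fix S assume S: "S \<in> {S. S \<subseteq> V \<and> (\<forall>x y. (x, y) \<in> r \<longrightarrow> x \<in> S \<longrightarrow> y \<in> S)}"
      have "S = \<Union>((\<lambda>x. r `` {x}) ` S)"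
        using S equiv_class_self[OF r] by blast
      moreover have "(\<lambda>x. r `` {x}) ` S \<subseteq> V // r" using S by (auto intro: quotientI)
      ultimately show "S \<in> Union ` Pow (V // r)" by blast
    qed
  qed
  from bij_betw_same_card[OF this] show ?thesis using card_Pow[OF fin] by simp
qed

lemma equiv_same_comp: "equiv S (same_comp S F)"
proof (rule equivI)
  show "refl_on S (same_comp S F)" by (auto simp: refl_on_def same_comp_def)
  have "sym (adj_on S F)" by (auto simp: sym_def adj_on_def)
  then have "sym ((adj_on S F)\<^sup>*)" by (rule sym_rtrancl)
  then show "sym (same_comp S F)" by (auto simp: sym_def same_comp_def)
  show "trans (same_comp S F)" by (auto simp: trans_def same_comp_def)
  show "same_comp S F \<subseteq> S \<times> S" by (auto simp: same_comp_def)
qed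

text \<open>\<open>S\<close> encodes a two-colouring of the vertices, and the edge is monochromatic.
  A loop is always uncut.\<close>

definition uncut :: "mgraph \<Rightarrow> nat set \<Rightarrow> nat \<Rightarrow> bool" where
  "uncut G S e \<longleftrightarrow> (fst (ends G ! e) \<in> S \<longleftrightarrow> snd (ends G ! e) \<in> S)"

lemma ends_in_verts:
  assumes "wf_mgraph G" "e \<in> edges G"
  shows "fst (ends G ! e) \<in> verts G" "snd (ends G ! e) \<in> verts G"
proof -
  have "ends G ! e \<in> verts G \<times> verts G"
    using assms nth_mem unfolding wf_mgraph_def edges_def by blast
  then show "fst (ends G ! e) \<in> verts G" "snd (ends G ! e) \<in> verts G" by auto
qed

text \<open>Cutting no edge of \<open>A\<close> means being saturated under the component relation.
  The inequalities between component numbers below are all obtained by comparing these powers of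
  two, without any reasoning about paths.\<close>

lemma card_uncut:
  assumes wf: "wf_mgraph G" and A: "A \<subseteq> edges G"
  shows "card {S. S \<subseteq> verts G \<and> (\<forall>e\<in>A. uncut G S e)} = 2 ^ num_comps G A"
proof -
  let ?F = "(!) (ends G) ` A"
  have "(\<forall>e\<in>A. uncut G S e) \<longleftrightarrow> (\<forall>x y. (x, y) \<in> same_comp (verts G) ?F \<longrightarrow> x \<in> S \<longrightarrow> y \<in> S)" (is "?L \<longleftrightarrow> ?R")
    if "S \<subseteq> verts G" for S
  proof
    assume L: ?L
    have st: "x \<in> S \<longrightarrow> y \<in> S" if xy: "(x, y) \<in> adj_on (verts G) ?F" for x y
    proof -
      have "(x, y) \<in> ?F \<or> (y, x) \<in> ?F" using xy by (auto simp: adj_on_def)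
      then obtain e where "e \<in> A" "(x, y) = ends G ! e \<or> (y, x) = ends G ! e" by blast
      then show ?thesis using L unfolding uncut_def by (metis fst_conv snd_conv)
    qed
    have "x \<in> S \<longrightarrow> y \<in> S" if "(x, y) \<in> (adj_on (verts G) ?F)\<^sup>*" for x y
      using that by (induction rule: rtrancl_induct) (use st in auto)
    then show ?R by (auto simp: same_comp_def)
  next
    assume R: ?R
    show ?L
    proof
      fix e assume e: "e \<in> A"
      obtain x y where xy: "ends G ! e = (x, y)" by (cases "ends G ! e")
      then have "(x, y) \<in> ?F" using e by (metis imageI)
      moreover have "x \<in> verts G" "y \<in> verts G" using ends_in_verts[OF wf, of e] e A xy by auto
      ultimately have "(x, y) \<in> adj_on (verts G) ?F" "(y, x) \<in> adj_on (verts G) ?F"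
        by (auto simp: adj_on_def)
      then have "(x, y) \<in> same_comp (verts G) ?F" "(y, x) \<in> same_comp (verts G) ?F"
        unfolding same_comp_def by (auto simp: adj_on_def)
      then show "uncut G S e" using R unfolding uncut_def xy by auto
    qed
  qed
  then have "{S. S \<subseteq> verts G \<and> (\<forall>e\<in>A. uncut G S e)} =
      {S. S \<subseteq> verts G \<and> (\<forall>x y. (x, y) \<in> same_comp (verts G) ?F \<longrightarrow> x \<in> S \<longrightarrow> y \<in> S)}" by blast
  then show ?thesis
    using card_saturated[OF _ equiv_same_comp, of "verts G" ?F] by (simp add: num_comps_def verts_def)
qed

lemma finite_edges [simp]: "finite (edges G)" and finite_verts [simp]: "finite (verts G)"
  by (simp_all add: edges_def verts_def)

lemma num_comps_antimono:
  assumes "wf_mgraph G" "A \<subseteq> E" "E \<subseteq> edges G"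
  shows "num_comps G E \<le> num_comps G A"
proof -
  have "card {S. S \<subseteq> verts G \<and> (\<forall>e\<in>E. uncut G S e)} \<le> card {S. S \<subseteq> verts G \<and> (\<forall>e\<in>A. uncut G S e)}"
    using assms(2) by (intro card_mono) auto
  then have "(2::nat) ^ num_comps G E \<le> 2 ^ num_comps G A" using assms by (simp add: card_uncut)
  then show ?thesis by simp
qed

text \<open>Symmetric difference with one fixed set that cuts \<open>e\<close> maps the sets cutting
  \<open>e\<close> injectively to sets not cutting it. Adding \<open>e\<close> thus at most halves
  the number of uncut sets.\<close>

lemma num_comps_insert:
  assumes wf: "wf_mgraph G" and A: "insert e A \<subseteq> edges G"
  shows "num_comps G A \<le> Suc (num_comps G (insert e A))"
proof -
  let ?C = "\<lambda>A. {S. S \<subseteq> verts G \<and> (\<forall>e\<in>A. uncut G S e)}"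
  let ?D = "{S \<in> ?C A. \<not> uncut G S e}"
  have fin: "finite (?C A)" for A by simp
  have "card ?D \<le> card (?C (insert e A))"
  proof (cases "?D = {}")
    case True
    then show ?thesis by (metis card.empty le0)
  next
    case False
    then obtain S0 where S0: "S0 \<in> ?D" by blast
    let ?f = "\<lambda>S. (S - S0) \<union> (S0 - S)"
    have "inj_on ?f ?D" by (rule inj_onI) blast
    moreover have "?f ` ?D \<subseteq> ?C (insert e A)" using S0 by (auto simp: uncut_def)
    ultimately show ?thesis by (rule card_inj_on_le[OF _ _ fin])
  qed
  moreover have "card (?C A) \<le> card ?D + card (?C (insert e A))"
  proof -
    have "?C A = ?D \<union> ?C (insert e A)" by auto
    then have "card (?C A) = card (?D \<union> ?C (insert e A))" by (rule arg_cong)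
    also have "\<dots> \<le> card ?D + card (?C (insert e A))" by (rule card_Un_le)
    finally show ?thesis .
  qed
  ultimately have "card (?C A) \<le> 2 * card (?C (insert e A))" by linarith
  then have "(2::nat) ^ num_comps G A \<le> 2 ^ Suc (num_comps G (insert e A))"
    using card_uncut[OF wf, of A] card_uncut[OF wf A] A by simp
  then show ?thesis by (rule power_le_imp_le_exp[rotated]) simp
qed

text \<open>Together with \<open>num_comps_antimono\<close> this makes the truncated subtractions in
  the exponents of \<open>tutte\<close> exact.\<close>

lemma card_verts_le_num_comps:
  assumes wf: "wf_mgraph G" and A: "A \<subseteq> edges G"
  shows "card (verts G) \<le> num_comps G A + card A"
proof -
  have "finite A" by (rule finite_subset[OF A finite_edges])
  then show ?thesis using A
  proof (induction A rule: finite_induct)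
    case empty
    have "(2::nat) ^ num_comps G {} = 2 ^ card (verts G)"
      using card_uncut[OF wf, of "{}"] card_Pow[of "verts G"] by (simp add: Pow_def)
    then show ?case by simp
  next
    case (insert e A)
    then show ?case using num_comps_insert[OF wf, of e A] by simp
  qed
qed

definition ising :: "mgraph \<Rightarrow> 'a::comm_ring_1 \<Rightarrow> 'a" where
  "ising G b = (\<Sum>S\<in>Pow (verts G). \<Prod>e\<in>edges G. if uncut G S e then b else 1)"

text \<open>The Fortuin-Kasteleyn expansion: an uncut edge contributes \<open>1 + (b - 1)\<close>
  and a cut edge \<open>1 + 0\<close>. After multiplying out, the product for an edge set
  \<open>A\<close> survives exactly for the sets \<open>S\<close> that cut no edge of
  \<open>A\<close>.\<close>

lemma ising_eq_sum_edge_sets: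
  assumes wf: "wf_mgraph G"
  shows "ising G b = (\<Sum>A\<in>Pow (edges G). 2 ^ num_comps G A * (b - 1) ^ card A)"
proof -
  have "ising G b = (\<Sum>S\<in>Pow (verts G). \<Prod>e\<in>edges G. 1 + (if uncut G S e then b - 1 else 0))"
    unfolding ising_def by (intro sum.cong prod.cong) auto
  also have "\<dots> = (\<Sum>S\<in>Pow (verts G). \<Sum>A\<in>Pow (edges G). \<Prod>e\<in>A. if uncut G S e then b - 1 else 0)"
    by (simp add: prod_add add.commute[of 1])
  also have "\<dots> = (\<Sum>A\<in>Pow (edges G). \<Sum>S\<in>Pow (verts G). \<Prod>e\<in>A. if uncut G S e then b - 1 else 0)"
    by (rule sum.swap)
  also have "\<dots> = (\<Sum>A\<in>Pow (edges G). 2 ^ num_comps G A * (b - 1) ^ card A)"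
  proof (rule sum.cong[OF refl])
    fix A assume A: "A \<in> Pow (edges G)"
    then have fin: "finite A" by (auto intro: finite_subset[OF _ finite_edges])
    have "(\<Prod>e\<in>A. if uncut G S e then b - 1 else 0) =
        (if \<forall>e\<in>A. uncut G S e then (b - 1) ^ card A else 0)" for S
      using fin by (auto simp: prod_constant intro!: prod_zero)
    then have "(\<Sum>S\<in>Pow (verts G). \<Prod>e\<in>A. if uncut G S e then b - 1 else 0) =
        (\<Sum>S\<in>Pow (verts G). if \<forall>e\<in>A. uncut G S e then (b - 1) ^ card A else 0)" by simp
    also have "\<dots> = (\<Sum>S\<in>{S \<in> Pow (verts G). \<forall>e\<in>A. uncut G S e}. (b - 1) ^ card A)"
      by (rule sum.inter_filter[symmetric]) simp
    also have "\<dots> = of_nat (card {S \<in> Pow (verts G). \<forall>e\<in>A. uncut G S e}) * (b - 1) ^ card A" by simp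
    also have "{S \<in> Pow (verts G). \<forall>e\<in>A. uncut G S e} = {S. S \<subseteq> verts G \<and> (\<forall>e\<in>A. uncut G S e)}" by auto
    finally show "(\<Sum>S\<in>Pow (verts G). \<Prod>e\<in>A. if uncut G S e then b - 1 else 0) =
        2 ^ num_comps G A * (b - 1) ^ card A"
      using card_uncut[OF wf] A by simp
  qed
  finally show ?thesis .
qed

text \<open>Multiplying a summand of \<open>tutte\<close> by the denominator completes both
  exponents, leaving \<open>((a - 1) * (b - 1)) ^ k(A) * (b - 1) ^ |A|\<close>, whose base is 2 on
  the curve. Dividing is allowed because 2 is nonzero.\<close>

lemma tutte_eq_ising:
  fixes a b :: "'a::field_char_0"
  assumes wf: "wf_mgraph G" and ab: "(a - 1) * (b - 1) = 2"
  shows "tutte G a b = ising G b / ((a - 1) ^ num_comps G (edges G) * (b - 1) ^ nverts G)"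
proof -
  let ?k = "num_comps G"
  have nz: "a - 1 \<noteq> 0" "b - 1 \<noteq> 0" using ab by auto
  have "((a - 1) ^ (?k A - ?k (edges G)) * (b - 1) ^ (?k A + card A - card (verts G))) *
     ((a - 1) ^ ?k (edges G) * (b - 1) ^ nverts G) = 2 ^ ?k A * (b - 1) ^ card A"
    if A: "A \<in> Pow (edges G)" for A
  proof -
    have 1: "(a - 1) ^ (?k A - ?k (edges G)) * (a - 1) ^ ?k (edges G) = (a - 1) ^ ?k A"
      using num_comps_antimono[OF wf, of A "edges G"] A by (simp flip: power_add)
    have 2: "(b - 1) ^ (?k A + card A - card (verts G)) * (b - 1) ^ nverts G = (b - 1) ^ (?k A + card A)"
      using card_verts_le_num_comps[OF wf, of A] A by (simp add: verts_def flip: power_add)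
    have "((a - 1) ^ (?k A - ?k (edges G)) * (b - 1) ^ (?k A + card A - card (verts G))) *
     ((a - 1) ^ ?k (edges G) * (b - 1) ^ nverts G) =
     ((a - 1) ^ (?k A - ?k (edges G)) * (a - 1) ^ ?k (edges G)) *
     ((b - 1) ^ (?k A + card A - card (verts G)) * (b - 1) ^ nverts G)" by (simp only: mult_ac)
    also have "\<dots> = ((a - 1) * (b - 1)) ^ ?k A * (b - 1) ^ card A"
      unfolding 1 2 by (simp add: power_add power_mult_distrib)
    finally show ?thesis using ab by simp
  qed
  then have "tutte G a b * ((a - 1) ^ ?k (edges G) * (b - 1) ^ nverts G) = ising G b"
    unfolding tutte_def ising_eq_sum_edge_sets[OF wf] sum_distrib_right by (intro sum.cong) auto
  then show ?thesis using nz by (simp add: field_simps)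
qed

section \<open>Eliminating a vertex\<close>

lemma sum_Pow_insert:
  assumes "finite R" "v \<notin> R"
  shows "(\<Sum>S\<in>Pow (insert v R). f S) = (\<Sum>S\<in>Pow R. f S + f (insert v S))"
proof -
  have "(\<Sum>S\<in>Pow (insert v R). f S) = (\<Sum>S\<in>Pow R. f S) + (\<Sum>S\<in>insert v ` Pow R. f S)"
    unfolding Pow_insert using assms by (intro sum.union_disjoint) auto
  also have "(\<Sum>S\<in>insert v ` Pow R. f S) = (\<Sum>S\<in>Pow R. f (insert v S))"
    using assms by (subst sum.reindex) (auto simp: inj_on_def)
  finally show ?thesis by (simp add: sum.distrib)
qed

definition mult :: "mgraph \<Rightarrow> nat \<Rightarrow> nat \<Rightarrow> nat" where
  "mult G u v = card {e \<in> edges G. ends G ! e = (u, v) \<or> ends G ! e = (v, u)}"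

definition edge_prod :: "mgraph \<Rightarrow> 'a::comm_ring_1 \<Rightarrow> nat set \<Rightarrow> nat set \<Rightarrow> 'a" where
  "edge_prod G b R S = (\<Prod>e\<in>{e \<in> edges G. fst (ends G ! e) \<in> R \<and> snd (ends G ! e) \<in> R}.
     if uncut G S e then b else 1)"

text \<open>Powers of \<open>b\<close> replace the individual parallel edges, so evaluation costs
  one multiplication per vertex. With \<open>v\<close> in \<open>U\<close> the loops at
  \<open>v\<close> are included, since \<open>v\<close> always agrees with itself.\<close>

definition star_prod :: "mgraph \<Rightarrow> 'a::comm_ring_1 \<Rightarrow> nat \<Rightarrow> nat set \<Rightarrow> nat set \<Rightarrow> 'a" where
  "star_prod G b v U S = (\<Prod>u\<in>U. if u \<in> S \<longleftrightarrow> v \<in> S then b ^ mult G v u else 1)"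

text \<open>The edges at \<open>v\<close> are grouped by their other end. A loop has
  \<open>v\<close> itself as other end, hence \<open>insert v U\<close>.\<close>

lemma edge_prod_remove:
  assumes R: "finite R" "v \<in> R" "insert v U \<subseteq> R"
    and nb: "\<And>e. e \<in> edges G \<Longrightarrow> fst (ends G ! e) \<in> R \<Longrightarrow> snd (ends G ! e) \<in> R \<Longrightarrow>
      v \<in> {fst (ends G ! e), snd (ends G ! e)} \<Longrightarrow> {fst (ends G ! e), snd (ends G ! e)} \<subseteq> insert v U"
  shows "edge_prod G b R S = edge_prod G b (R - {v}) S * star_prod G b v (insert v U) S"
proof -
  let ?w = "\<lambda>e. if uncut G S e then b else 1"
  let ?x = "\<lambda>e. fst (ends G ! e)" and ?y = "\<lambda>e. snd (ends G ! e)"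
  let ?E = "\<lambda>R. {e \<in> edges G. ?x e \<in> R \<and> ?y e \<in> R}"
  let ?Ev = "{e \<in> ?E R. ?x e = v \<or> ?y e = v}"
  let ?o = "\<lambda>e. if ?x e = v then ?y e else ?x e"
  have fin: "finite (?E R)" for R by simp
  have "?E R = ?E (R - {v}) \<union> ?Ev" by auto
  then have "edge_prod G b R S = prod ?w (?E (R - {v}) \<union> ?Ev)"
    unfolding edge_prod_def by (rule arg_cong)
  also have "\<dots> = edge_prod G b (R - {v}) S * prod ?w ?Ev"
    unfolding edge_prod_def by (rule prod.union_disjoint) auto
  also have "prod ?w ?Ev = (\<Prod>u\<in>insert v U. \<Prod>e\<in>{e \<in> ?Ev. ?o e = u}. ?w e)"
  proof (rule prod.group[symmetric])
    show "?o ` ?Ev \<subseteq> insert v U" using nb by force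
    show "finite (insert v U)" using finite_subset[OF R(3,1)] .
  qed (use fin in auto)
  also have "\<dots> = star_prod G b v (insert v U) S"
    unfolding star_prod_def
  proof (rule prod.cong[OF refl])
    fix u assume u: "u \<in> insert v U"
    have eq: "{e \<in> ?Ev. ?o e = u} = {e \<in> edges G. ends G ! e = (v, u) \<or> ends G ! e = (u, v)}"
      using u R by (auto simp: prod_eq_iff)
    have "?w e = (if u \<in> S \<longleftrightarrow> v \<in> S then b else 1)" if "e \<in> {e \<in> ?Ev. ?o e = u}" for e
      using that unfolding eq by (auto simp: uncut_def)
    then have "(\<Prod>e\<in>{e \<in> ?Ev. ?o e = u}. ?w e) = (\<Prod>e\<in>{e \<in> ?Ev. ?o e = u}. if u \<in> S \<longleftrightarrow> v \<in> S then b else 1)"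
      by (rule prod.cong[OF refl])
    also have "\<dots> = (if u \<in> S \<longleftrightarrow> v \<in> S then b ^ mult G v u else 1)"
      unfolding eq mult_def by (simp add: prod_constant)
    finally show "(\<Prod>e\<in>{e \<in> ?Ev. ?o e = u}. ?w e) = (if u \<in> S \<longleftrightarrow> v \<in> S then b ^ mult G v u else 1)" .
  qed
  finally show ?thesis .
qed

lemma edge_prod_cong: "S \<inter> R = S' \<inter> R \<Longrightarrow> edge_prod G b R S = edge_prod G b R S'"
  unfolding edge_prod_def uncut_def by (intro prod.cong refl) (auto simp: set_eq_iff)

lemma star_prod_cong:
  "v \<in> U \<Longrightarrow> S \<inter> U = S' \<inter> U \<Longrightarrow> star_prod G b v U S = star_prod G b v U S'"
  unfolding star_prod_def by (intro prod.cong refl) (auto simp: set_eq_iff)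

text \<open>The part of the summand that depends on the side of \<open>v\<close>, before the
  summation over that side; \<open>S\<close> records this side too.\<close>

definition message :: "mgraph \<Rightarrow> 'a::comm_ring_1 \<Rightarrow> nat \<Rightarrow> nat set \<Rightarrow> nat set \<Rightarrow>
    (nat \<Rightarrow> nat set \<Rightarrow> 'a) \<Rightarrow> nat set \<Rightarrow> 'a" where
  "message G b v U J f S = star_prod G b v (insert v U) S * (\<Prod>j\<in>J. f j S)"

text \<open>Distributivity: the edges away from \<open>v\<close> and the factors outside
  \<open>J\<close> do not see the side of \<open>v\<close> and leave the inner sum. The rest depends
  on \<open>S\<close> only within \<open>insert v U\<close>, so it can be tabulated over the subsets
  of \<open>U\<close>. The name \<open>v\<close> is free for the new factor because
  \<open>v \<notin> A\<close>.\<close>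

lemma eliminate_vertex:
  fixes f f' :: "nat \<Rightarrow> nat set \<Rightarrow> 'a::comm_ring_1"
  assumes R: "finite R" "v \<in> R" "U \<subseteq> R - {v}"
    and nb: "\<And>e. e \<in> edges G \<Longrightarrow> fst (ends G ! e) \<in> R \<Longrightarrow> snd (ends G ! e) \<in> R \<Longrightarrow>
      v \<in> {fst (ends G ! e), snd (ends G ! e)} \<Longrightarrow> {fst (ends G ! e), snd (ends G ! e)} \<subseteq> insert v U"
    and A: "finite A" "v \<notin> A"
    and D: "\<And>j. j \<in> A \<Longrightarrow> v \<in> D j \<Longrightarrow> D j \<subseteq> insert v U"
    and loc: "\<And>j S. j \<in> A \<Longrightarrow> f j S = f j (S \<inter> D j)"
    and J: "J = {j \<in> A. v \<in> D j}"
    and f'v: "\<And>S. f' v S = message G b v U J f (S \<inter> U) + message G b v U J f (insert v (S \<inter> U))"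
    and f': "\<And>j S. j \<in> A - J \<Longrightarrow> f' j S = f j S"
  shows "(\<Sum>S\<in>Pow R. edge_prod G b R S * (\<Prod>j\<in>A. f j S)) =
    (\<Sum>S\<in>Pow (R - {v}). edge_prod G b (R - {v}) S * (\<Prod>j\<in>insert v (A - J). f' j S))"
proof -
  let ?R = "R - {v}"
  let ?F = "\<lambda>S. edge_prod G b R S * (\<Prod>j\<in>A. f j S)"
  let ?m = "message G b v U J f"
  have JA: "J \<subseteq> A" "finite J" using J A(1) by auto
  have m_cong: "?m T = ?m T'" if T: "T \<inter> insert v U = T' \<inter> insert v U" for T T'
  proof -
    have "f j T = f j T'" if j: "j \<in> J" for j
    proof -
      have "D j \<subseteq> insert v U" "j \<in> A" using D j J by auto
      then have "T \<inter> D j = T' \<inter> D j" using T by blast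
      then show ?thesis using loc[OF \<open>j \<in> A\<close>] by metis
    qed
    then show ?thesis
      unfolding message_def using star_prod_cong[OF _ T, of v G b] by simp
  qed
  have F: "?F T = edge_prod G b ?R S * (\<Prod>j\<in>A - J. f j S) * ?m T"
    if T: "T - {v} = S - {v}" for S T
  proof -
    have "edge_prod G b R T = edge_prod G b ?R T * star_prod G b v (insert v U) T"
      using R by (intro edge_prod_remove nb) auto
    moreover have "edge_prod G b ?R T = edge_prod G b ?R S"
      using T by (intro edge_prod_cong) blast
    moreover have "(\<Prod>j\<in>A. f j T) = (\<Prod>j\<in>A - J. f j T) * (\<Prod>j\<in>J. f j T)"
      using prod.subset_diff[OF JA(1) A(1)] .
    moreover have "(\<Prod>j\<in>A - J. f j T) = (\<Prod>j\<in>A - J. f j S)"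
    proof (rule prod.cong[OF refl])
      fix j assume j: "j \<in> A - J"
      then have "v \<notin> D j" "j \<in> A" using J by auto
      then have "T \<inter> D j = S \<inter> D j" using T by blast
      then show "f j T = f j S" using loc[OF \<open>j \<in> A\<close>] by metis
    qed
    ultimately show ?thesis unfolding message_def by (simp add: mult_ac)
  qed
  have "R = insert v ?R" using R by auto
  then have "(\<Sum>S\<in>Pow R. ?F S) = (\<Sum>S\<in>Pow (insert v ?R). ?F S)" by (rule arg_cong)
  also have "\<dots> = (\<Sum>S\<in>Pow ?R. ?F S + ?F (insert v S))"
    using R by (intro sum_Pow_insert) auto
  also have "\<dots> = (\<Sum>S\<in>Pow ?R. edge_prod G b ?R S * (\<Prod>j\<in>insert v (A - J). f' j S))"
  proof (rule sum.cong[OF refl])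
    fix S assume S: "S \<in> Pow ?R"
    have "f' v S = ?m S + ?m (insert v S)"
      unfolding f'v using R(3) S by (intro arg_cong2[of _ _ _ _ "(+)"] m_cong) auto
    moreover have "(\<Prod>j\<in>A - J. f' j S) = (\<Prod>j\<in>A - J. f j S)" using f' by (intro prod.cong) auto
    ultimately have "(\<Prod>j\<in>insert v (A - J). f' j S) = (?m S + ?m (insert v S)) * (\<Prod>j\<in>A - J. f j S)"
      using A by simp
    then show "?F S + ?F (insert v S) = edge_prod G b ?R S * (\<Prod>j\<in>insert v (A - J). f' j S)"
      using F[of S S] F[of "insert v S" S] by (simp add: algebra_simps)
  qed
  finally show ?thesis .
qed

section \<open>Subsets of a scope as binary numbers\<close>

definition code :: "nat set \<Rightarrow> nat \<Rightarrow> nat set \<Rightarrow> nat" where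
  "code D n S = (\<Sum>u\<in>S \<inter> D \<inter> {..<n}. 2 ^ card (D \<inter> {..<u}))"

definition decode :: "nat set \<Rightarrow> nat \<Rightarrow> nat set" where
  "decode D x = {u \<in> D. odd (x div 2 ^ card (D \<inter> {..<u}))}"

lemma card_Int_lessThan_Suc:
  "card (D \<inter> {..<Suc u}) = card (D \<inter> {..<u}) + of_bool (u \<in> D)"
  by (auto simp: lessThan_Suc)

lemma code_Suc: "code D (Suc n) S = code D n S + of_bool (n \<in> S \<and> n \<in> D) * 2 ^ card (D \<inter> {..<n})"
  by (auto simp: code_def lessThan_Suc Int_insert_right)

lemma code_less: "code D n S < 2 ^ card (D \<inter> {..<n})"
proof (induction n)
  case (Suc n)
  then show ?case by (auto simp: code_Suc card_Int_lessThan_Suc)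
qed (simp add: code_def)

lemma code_local: "code D n S = code D n (S \<inter> D)"
  by (simp add: code_def)

text \<open>Each element of \<open>D\<close> owns the bit given by its rank in \<open>D\<close>. In
  the induction the new bit either is the one queried, with all others below it by
  \<open>code_less\<close>, or it adds an even multiple of the place value queried.\<close>

lemma decode_code:
  assumes "D \<subseteq> {..<n}"
  shows "decode D (code D n S) = S \<inter> D"
proof -
  have "odd (code D n S div 2 ^ card (D \<inter> {..<u})) \<longleftrightarrow> u \<in> S" if "u \<in> D" "u < n" for u
    using that(2)
  proof (induction n)
    case (Suc n)
    show ?case
    proof (cases "u = n")
      case True
      then show ?thesis using code_less[of D n S] that(1) by (auto simp: code_Suc)
    next
      case False
      then have u: "u < n" using Suc.prems by simp
      have "D \<inter> {..<Suc u} \<subseteq> D \<inter> {..<n}" using u by auto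
      then have "card (D \<inter> {..<Suc u}) \<le> card (D \<inter> {..<n})" by (intro card_mono) auto
      then have "Suc (card (D \<inter> {..<u})) \<le> card (D \<inter> {..<n})"
        using that(1) by (simp add: card_Int_lessThan_Suc)
      then obtain k where "card (D \<inter> {..<n}) = Suc (card (D \<inter> {..<u})) + k" using le_Suc_ex by blast
      then have k: "(2::nat) ^ card (D \<inter> {..<n}) = 2 ^ card (D \<inter> {..<u}) * (2 * 2 ^ k)"
        by (simp add: power_add)
      show ?thesis using Suc.IH[OF u] unfolding code_Suc k by auto
    qed
  qed simp
  then show ?thesis using assms by (auto simp: decode_def)
qed

section \<open>Preprocessing the input\<close>

text \<open>Row-major addressing; register 0 holds the number of vertices, the common row length.
  The tables of factors are columns, so a table may have any length without a layout fixed in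
  advance.\<close>

definition cell :: "wexp \<Rightarrow> wexp \<Rightarrow> wexp" where
  "cell x y = WOp WAdd (WOp WMul x (WReg 0)) y"

lemma wcost_cell [simp]: "wcost (cell x y) = wcost x + wcost y + 3"
  by (simp add: cell_def)

lemma wval_cell:
  assumes "wval W s x * wreg s 0 + wval W s y < 2 ^ W"
  shows "wval W s (cell x y) = wval W s x * wreg s 0 + wval W s y"
  using assms by (simp add: cell_def)

lemma cell_inj:
  fixes n :: nat
  assumes "y < n" "y' < n"
  shows "x * n + y = x' * n + y' \<longleftrightarrow> x = x' \<and> y = y'"
proof
  assume eq: "x * n + y = x' * n + y'"
  then have "(x * n + y) div n = (x' * n + y') div n" "(x * n + y) mod n = (x' * n + y') mod n" by simp_all
  then show "x = x' \<and> y = y'" using assms by simp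
qed simp

lemma cell_less:
  fixes n :: nat
  assumes "x < k" "y < n"
  shows "x * n + y < k * n"
proof -
  have "x * n + y < Suc x * n" using assms(2) by simp
  also have "\<dots> \<le> k * n" using assms(1) by (intro mult_right_mono) auto
  finally show ?thesis .
qed

text \<open>
  Word array 6 holds the incidence matrix of bags and vertices, array 7 the status of each vertex
  (0: remaining, 1: eliminated and its factor still pending, 2: factor absorbed by a later one),
  array 8 the scopes of the factors as a matrix, array 9 the current side of each vertex, and array
  10 component labels.  Number array 0 holds \<open>b\<close> to the edge multiplicities, and entry \<open>x * n + v\<close>
  of number array 1 the factor of \<open>v\<close> at the subset of its scope with code \<open>x\<close>.
\<close>

definition weights_loop :: com where
  "weights_loop = For 4 (WReg 1) (Seq
     (NStore 0 (cell (WLoad 0 (WReg 4)) (WLoad 1 (WReg 4)))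
       (NOp NMul (NLoad 0 (cell (WLoad 0 (WReg 4)) (WLoad 1 (WReg 4)))) (NReg 1)))
     (If_then (BNot (WEq (WLoad 0 (WReg 4)) (WLoad 1 (WReg 4))))
       (NStore 0 (cell (WLoad 1 (WReg 4)) (WLoad 0 (WReg 4)))
         (NOp NMul (NLoad 0 (cell (WLoad 1 (WReg 4)) (WLoad 0 (WReg 4)))) (NReg 1)))))"

definition weights :: com where
  "weights = Seq (For 4 (WOp WMul (WReg 0) (WReg 0)) (NStore 0 (WReg 4) NOne)) weights_loop"

text \<open>The quick-find form of merging: the label in register 5 is overwritten by that in
  register 6 at all vertices.\<close>

definition relabel :: com where
  "relabel = For 7 (WReg 0)
     (If_then (WEq (WLoad 10 (WReg 7)) (WReg 5)) (WStore 10 (WReg 7) (WReg 6)))"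

definition labels_loop :: com where
  "labels_loop = For 4 (WReg 1)
     (Seq (WSet 5 (WLoad 10 (WLoad 0 (WReg 4))))
     (Seq (WSet 6 (WLoad 10 (WLoad 1 (WReg 4)))) relabel))"

definition labels :: com where
  "labels = Seq (For 4 (WReg 0) (WStore 10 (WReg 4) (WReg 4))) labels_loop"

definition membership_bag :: com where
  "membership_bag = For 6 (WLoad 4 (WReg 4))
     (Seq (WStore 6 (cell (WReg 4) (WLoad 5 (WReg 5))) (WConst 1))
          (WSet 5 (WOp WAdd (WReg 5) (WConst 1))))"

definition membership :: com where
  "membership = Seq (WSet 5 (WConst 0)) (For 4 (WReg 3) membership_bag)"

lemma array_of_nth [simp]: "i < length xs \<Longrightarrow> array_of xs i = xs ! i"
  by (simp add: array_of_def)

lemma card_less_Suc_filter: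
  "card {e. e < Suc i \<and> P e} = card {e. e < i \<and> P e} + of_bool (P i)" for i :: nat
proof -
  have "{e. e < Suc i \<and> P e} = {e. e < i \<and> P e} \<union> (if P i then {i} else {})"
    by (auto simp: less_Suc_eq)
  then show ?thesis by auto
qed

text \<open>\<open>lab\<close> chooses a representative of each component: it stays inside the
  component, is constant along edges, and fixes the representatives. Counting fixed points therefore
  counts components.\<close>

lemma num_comps_labels:
  assumes lab: "\<And>v. v < nverts G \<Longrightarrow> (v, lab v) \<in> same_comp (verts G) ((!) (ends G) ` edges G)"
    and lab_ends: "\<And>e. e \<in> edges G \<Longrightarrow> lab (fst (ends G ! e)) = lab (snd (ends G ! e))"
    and idem: "\<And>v. v < nverts G \<Longrightarrow> lab (lab v) = lab v"
  shows "num_comps G (edges G) = card {v. v < nverts G \<and> lab v = v}"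
proof -
  let ?V = "verts G" and ?F = "(!) (ends G) ` edges G"
  let ?r = "same_comp ?V ?F"
  have eq: "equiv ?V ?r" by (rule equiv_same_comp)
  have step: "lab x = lab y" if "(x, y) \<in> adj_on ?V ?F" for x y
  proof -
    have "(x, y) \<in> ?F \<or> (y, x) \<in> ?F" using that by (auto simp: adj_on_def)
    then obtain e where "e \<in> edges G" "(x, y) = ends G ! e \<or> (y, x) = ends G ! e" by blast
    then show ?thesis using lab_ends by (metis fst_conv snd_conv)
  qed
  have "lab x = lab y" if "(x, y) \<in> (adj_on ?V ?F)\<^sup>*" for x y
    using that by (induction rule: rtrancl_induct) (use step in auto)
  then have const: "lab x = lab y" if "(x, y) \<in> ?r" for x y using that by (auto simp: same_comp_def)
  have fix_V: "lab v \<in> ?V" if "v \<in> ?V" for v using lab[of v] that by (auto simp: same_comp_def verts_def)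
  have "bij_betw (\<lambda>v. ?r `` {v}) {v. v < nverts G \<and> lab v = v} (?V // ?r)"
  proof (rule bij_betw_imageI)
    show "inj_on (\<lambda>v. ?r `` {v}) {v. v < nverts G \<and> lab v = v}"
    proof (rule inj_onI)
      fix x y assume xy: "x \<in> {v. v < nverts G \<and> lab v = v}" "y \<in> {v. v < nverts G \<and> lab v = v}"
        "?r `` {x} = ?r `` {y}"
      then have "(x, y) \<in> ?r" using eq_equiv_class[OF xy(3) eq] by (auto simp: verts_def)
      then show "x = y" using const[of x y] xy(1,2) by simp
    qed
    show "(\<lambda>v. ?r `` {v}) ` {v. v < nverts G \<and> lab v = v} = ?V // ?r"
    proof (intro equalityI subsetI)
      fix C assume "C \<in> ?V // ?r"
      then obtain x where x: "x \<in> ?V" "C = ?r `` {x}" by (rule quotientE)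
      then have "C = ?r `` {lab x}" using equiv_class_eq[OF eq lab[of x]] by (simp add: verts_def)
      moreover have "lab x < nverts G" "lab (lab x) = lab x" using fix_V[OF x(1)] idem x(1) by (auto simp: verts_def)
      ultimately show "C \<in> (\<lambda>v. ?r `` {v}) ` {v. v < nverts G \<and> lab v = v}" by blast
    qed (auto simp: verts_def intro: quotientI)
  qed
  from bij_betw_same_card[OF this] show ?thesis by (simp add: num_comps_def)
qed

section \<open>Correctness of the preprocessing\<close>

locale tutte_input =
  fixes G :: mgraph and F :: "(nat \<times> nat) list" and B :: "nat list list"
    and a b :: "'a::field_char_0" and W :: nat
  assumes wf: "wf_mgraph G"
    and td: "encodes_tree_decomposition G F B"
    and word_bound: "100 * (2 ^ width (length B) (bag B) * nverts G ^ 5 + input_size G F B ^ 5) \<le> 2 ^ W"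
begin

abbreviation "n \<equiv> nverts G"
abbreviation "m \<equiv> length (ends G)"
abbreviation "N \<equiv> length B"
abbreviation "sz \<equiv> input_size G F B"
text \<open>Two to the largest permitted bag size. A scope lies in a bag, and this rough count loses
  only a constant factor against \<open>2 ^ width\<close>.\<close>

abbreviation "bound \<equiv> (2::nat) ^ Suc (width (length B) (bag B))"

lemma N_pos: "0 < N"
  using td by (auto simp: encodes_tree_decomposition_def tree_decomposition_def is_tree_def)

lemma sz_ge: "n \<le> sz" "m \<le> sz" "N \<le> sz" "length (concat B) \<le> sz" "1 \<le> sz"
  using N_pos unfolding input_size_def by linarith+

lemma sz_word: "100 * sz ^ k \<le> 2 ^ W" if "k \<le> 5"
proof -
  have "sz ^ k \<le> sz ^ 5" using that sz_ge by (intro power_increasing) auto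
  then show ?thesis using word_bound unfolding distrib_left by linarith
qed

lemma sz1_word: "100 * sz \<le> 2 ^ W"
  using sz_word[of 1] by simp

lemma two_word: "2 < (2::nat) ^ W"
  using sz_word[of 0] by simp

lemma W_pos [simp]: "0 < W"
  using two_word by (cases W) auto

lemma two_mod [simp]: "2 mod (2::nat) ^ W = 2"
  using two_word by simp

lemma word_less: "k \<le> sz \<Longrightarrow> Suc k < 2 ^ W"
  using sz1_word sz_ge(5) by linarith

lemma cell_word: "x < sz \<Longrightarrow> y < n \<Longrightarrow> x * n + y < 2 ^ W"
proof -
  assume xy: "x < sz" "y < n"
  have "x * n + y < sz * n" using xy by (rule cell_less)
  also have "\<dots> \<le> sz ^ 2" using sz_ge by (simp add: power2_eq_square)
  also have "\<dots> \<le> 2 ^ W" using sz_word[of 2] by simp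
  finally show ?thesis .
qed

text \<open>The factor \<open>n\<close> covers the index of every table entry; the factor 2 leaves
  room for doubling a place value.\<close>

lemma bound_word: "0 < n \<Longrightarrow> 2 * bound * n < 2 ^ W"
proof -
  assume n: "0 < n"
  then have "n * 1 \<le> n * n ^ 4" by (intro mult_left_mono) auto
  then have "n \<le> n ^ 5" by (simp add: power_Suc[symmetric] del: power_Suc) 
  then have "2 ^ width (length B) (bag B) * n \<le> 2 ^ width (length B) (bag B) * n ^ 5" by simp
  moreover have "0 < 2 ^ width (length B) (bag B) * n" using n by simp
  moreover have "2 * bound * n = 4 * (2 ^ width (length B) (bag B) * n)" by simp
  ultimately show ?thesis using word_bound unfolding distrib_left by linarith
qed

lemma table_word: "x < bound \<Longrightarrow> y < n \<Longrightarrow> x * n + y < 2 ^ W"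
  using cell_less[of x bound y n] bound_word by fastforce

lemma bag_subset: "t < N \<Longrightarrow> bag B t \<subseteq> verts G"
  using td by (auto simp: encodes_tree_decomposition_def tree_decomposition_def)

lemma card_bag: "t < N \<Longrightarrow> card (bag B t) \<le> Suc (width N (bag B))"
proof -
  assume "t < N"
  then have "card (bag B t) \<le> Max ((\<lambda>t. card (bag B t)) ` {..<N})" by (intro Max_ge) auto
  then show ?thesis by (simp add: width_def)
qed

lemma ends_less:
  assumes "e < m"
  shows "fst (ends G ! e) < n" "snd (ends G ! e) < n"
  using ends_in_verts[OF wf, of e] assms by (auto simp: edges_def verts_def)

definition inputs :: "'a state \<Rightarrow> bool" where
  "inputs s \<longleftrightarrow> wreg s 0 = n \<and> wreg s 1 = m \<and> wreg s 3 = N \<and>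
     warr s 0 = array_of (map fst (ends G)) \<and> warr s 1 = array_of (map snd (ends G)) \<and>
     warr s 4 = array_of (map length B) \<and> warr s 5 = array_of (concat B) \<and>
     nreg s 0 = a \<and> nreg s 1 = b"

lemma wp_weights_loop:
  assumes s: "inputs s" and one: "\<And>k. k < n * n \<Longrightarrow> narr s 0 k = 1"
  shows "wp W weights_loop s (\<lambda>t s'. t \<le> m * 100 + 100 \<and>
    (\<forall>u<n. \<forall>v<n. narr s' 0 (u * n + v) = b ^ mult G u v))"
  unfolding weights_loop_def
proof (rule wp_For[where n = m and T = 60 and
      I = "\<lambda>i s'. \<forall>u<n. \<forall>v<n. narr s' 0 (u * n + v) =
        b ^ card {e. e < i \<and> (ends G ! e = (u, v) \<or> ends G ! e = (v, u))}"], goal_cases)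
  case 1
  show ?case using word_less[OF sz_ge(2)] by simp
next
  case (3 i s')
  then show ?case using s by (simp add: frame_def inputs_def)
next
  case 4
  show ?case using one cell_less by auto
next
  case (5 i s')
  obtain x y where xy: "ends G ! i = (x, y)" by (cases "ends G ! i")
  then have xyn: "x < n" "y < n" using ends_less[OF 5(1)] by auto
  have w: "wreg s' 0 = n" "warr s' 0 i = x" "warr s' 1 i = y" "nreg s' 1 = b"
    using 5(4) s xy 5(1) by (simp_all add: frame_def inputs_def)
  have c: "x * n + y < 2 ^ W" "y * n + x < 2 ^ W" using cell_word xyn sz_ge(1) by auto
  show ?case using xyn 5(2,3) w c
    by (auto simp: wval_cell cell_inj card_less_Suc_filter xy)
next
  case (6 t s')
  then show ?case by (auto simp: mult_def edges_def)
qed simp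

lemma wp_weights:
  assumes s: "inputs s"
  shows "wp W weights s (\<lambda>t s'. t \<le> n * n * 100 + m * 100 + 200 \<and>
    (\<forall>u<n. \<forall>v<n. narr s' 0 (u * n + v) = b ^ mult G u v))"
  unfolding weights_def wp_Seq
proof (rule wp_For[where n = "n * n" and T = 3 and I = "\<lambda>i s'. \<forall>k<i. narr s' 0 k = 1"], goal_cases)
  case 1
  have "n * n \<le> sz ^ 2" using sz_ge(1) by (simp add: power2_eq_square mult_mono)
  also have "\<dots> < 2 ^ W" using sz_word[of 2] sz_ge(5) by (simp add: less_le_trans[rotated])
  finally show ?case .
next
  case (3 i s')
  have "n * n \<le> sz ^ 2" using sz_ge(1) by (simp add: power2_eq_square mult_mono)
  also have "\<dots> < 2 ^ W" using sz_word[of 2] sz_ge(5) by (simp add: less_le_trans[rotated])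
  finally show ?case using 3 s by (simp add: frame_def inputs_def)
next
  case (6 t s')
  then have "inputs s'" using s by (simp add: frame_def inputs_def)
  then show ?case by (rule wp_mono[OF wp_weights_loop]) (use 6(1,2) in auto)
qed (auto simp: less_Suc_eq)

lemma wp_relabel:
  assumes s: "inputs s"
  shows "wp W relabel s (\<lambda>t s'. t \<le> n * 30 + 10 \<and>
    (\<forall>v<n. warr s' 10 v = (if warr s 10 v = wreg s 5 then wreg s 6 else warr s 10 v)))"
  unfolding relabel_def
proof (rule wp_For[where n = n and T = 15 and I = "\<lambda>i s'. \<forall>v<n. warr s' 10 v =
      (if v < i \<and> warr s 10 v = wreg s 5 then wreg s 6 else warr s 10 v)"], goal_cases)
  case 1
  show ?case using word_less[OF sz_ge(1)] by simp
next
  case (3 i s')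
  then show ?case using s by (simp add: frame_def inputs_def)
next
  case (5 i s')
  then show ?case by (auto simp: frame_def less_Suc_eq)
qed auto

text \<open>The invariant consists of the hypotheses of \<open>num_comps_labels\<close> for the
  first \<open>i\<close> edges. Replacing one label by another everywhere preserves equalities
  between labels, so edges already treated stay consistent.\<close>

lemma wp_labels_loop:
  assumes s: "inputs s" and id: "\<And>v. v < n \<Longrightarrow> warr s 10 v = v"
  shows "wp W labels_loop s (\<lambda>t s'. t \<le> m * (n * 30 + 50) + 10 \<and>
    card {v. v < n \<and> warr s' 10 v = v} = num_comps G (edges G))"
  unfolding labels_loop_def
proof (rule wp_For[where n = m and T = "n * 30 + 30" and
      I = "\<lambda>i s'. (\<forall>v<n. (v, warr s' 10 v) \<in> same_comp (verts G) ((!) (ends G) ` edges G)) \<and>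
        (\<forall>e<i. warr s' 10 (fst (ends G ! e)) = warr s' 10 (snd (ends G ! e))) \<and>
        (\<forall>v<n. warr s' 10 (warr s' 10 v) = warr s' 10 v)"], goal_cases)
  case 1
  show ?case using word_less[OF sz_ge(2)] by simp
next
  case 2
  show ?case by (simp add: relabel_def)
next
  case (3 i s')
  then show ?case using s by (simp add: frame_def inputs_def relabel_def)
next
  case 4
  show ?case using id by (auto simp: same_comp_def verts_def)
next
  case (5 i s')
  let ?r = "same_comp (verts G) ((!) (ends G) ` edges G)"
  obtain x y where xy: "ends G ! i = (x, y)" by (cases "ends G ! i")
  then have xyn: "x < n" "y < n" using ends_less[OF 5(1)] by auto
  have r_trans: "trans ?r" and r_sym: "sym ?r"
    using equiv_same_comp[of "verts G" "(!) (ends G) ` edges G"] by (auto elim: equivE)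
  have "(x, y) \<in> (!) (ends G) ` edges G" using xy 5(1) by (force simp: edges_def)
  then have xyr: "(x, y) \<in> ?r" using xyn by (auto simp: same_comp_def verts_def adj_on_def)
  define lab where "lab = warr s' 10"
  have lab: "\<And>v. v < n \<Longrightarrow> (v, lab v) \<in> ?r" "\<And>e. e < i \<Longrightarrow> lab (fst (ends G ! e)) = lab (snd (ends G ! e))"
    "\<And>v. v < n \<Longrightarrow> lab (lab v) = lab v" using 5(2) by (auto simp: lab_def)
  have lab_n: "lab v < n" if "v < n" for v using lab(1)[OF that] by (auto simp: same_comp_def verts_def)
  define s1 where "s1 = s'\<lparr>wreg := (wreg s')(5 := lab x, 6 := lab y)\<rparr>"
  have s1: "inputs s1" "wreg s1 5 = lab x" "wreg s1 6 = lab y" "warr s1 10 = lab"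
    using 5(4) s by (auto simp: frame_def inputs_def s1_def lab_def relabel_def)
  have xyr': "(lab x, lab y) \<in> ?r"
    using lab(1)[OF xyn(1)] lab(1)[OF xyn(2)] xyr r_trans r_sym by (meson symD transD)
  have w: "warr s' 0 i = x" "warr s' 1 i = y"
    using 5(4) s xy 5(1) by (simp_all add: frame_def inputs_def relabel_def)
  have "wp W relabel s1 (\<lambda>t s''. t + 9 \<le> n * 30 + 30 \<and>
    (let l = warr s'' 10 in (\<forall>v<n. (v, l v) \<in> ?r) \<and>
      (\<forall>e<Suc i. l (fst (ends G ! e)) = l (snd (ends G ! e))) \<and> (\<forall>v<n. l (l v) = l v)))"
  proof (rule wp_mono[OF wp_relabel[OF s1(1)]], goal_cases)
    case (1 t s'')
    define l where "l = warr s'' 10"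
    have l: "l v = (if lab v = lab x then lab y else lab v)" if "v < n" for v
      using 1 s1 that by (auto simp: l_def)
    have "(v, l v) \<in> ?r" if "v < n" for v
      using l[OF that] lab(1)[OF that] xyr' r_trans by (auto dest: transD)
    moreover have "l (fst (ends G ! e)) = l (snd (ends G ! e))" if "e < Suc i" for e
    proof -
      have "e < m" using that 5(1) by simp
      then show ?thesis using that ends_less[of e] l lab(2)[of e] xy xyn by (auto simp: less_Suc_eq)
    qed
    \<comment> \<open>The surviving label \<open>lab y\<close> is a fixed point of
      \<open>lab\<close>, and \<open>l\<close> sends it to \<open>lab y\<close> whether or not it
      equals \<open>lab x\<close>.\<close>
    moreover have "l (l v) = l v" if "v < n" for v
      using l[OF that] l[OF lab_n[OF that]] l[OF lab_n[OF xyn(2)]] lab(3) that xyn by auto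
    ultimately show ?case using 1 by (simp add: l_def[symmetric] Let_def)
  qed
  then show ?case
    using w 5(3) by (auto simp: s1_def lab_def Let_def elim!: wp_mono)
next
  case (6 t s')
  have "num_comps G (edges G) = card {v. v < n \<and> warr s' 10 v = v}"
    using 6(2) by (intro num_comps_labels) (auto simp: edges_def)
  then show ?case using 6(1) by (simp add: algebra_simps)
qed

lemma wp_labels:
  assumes s: "inputs s"
  shows "wp W labels s (\<lambda>t s'. t \<le> m * (n * 30 + 50) + n * 20 + 20 \<and>
    card {v. v < n \<and> warr s' 10 v = v} = num_comps G (edges G))"
  unfolding labels_def wp_Seq
proof (rule wp_For[where n = n and T = 3 and I = "\<lambda>i s'. \<forall>k<i. warr s' 10 k = k"], goal_cases)
  case 1
  show ?case using word_less[OF sz_ge(1)] by simp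
next
  case (3 i s')
  then show ?case using s by (simp add: frame_def inputs_def)
next
  case (6 t s')
  then have "inputs s'" using s by (simp add: frame_def inputs_def)
  then show ?case by (rule wp_mono[OF wp_labels_loop]) (use 6(1,2) in auto)
qed (auto simp: less_Suc_eq)

lemma concat_nth_bag:
  assumes "i < N" "k < length (B ! i)"
  shows "length (concat (take i B)) + k < length (concat B)"
    "concat B ! (length (concat (take i B)) + k) = B ! i ! k"
proof -
  have "concat B = concat (take i B) @ B ! i @ concat (drop (Suc i) B)"
    using id_take_nth_drop[OF assms(1)] by (metis concat.simps(2) concat_append)
  then show "length (concat (take i B)) + k < length (concat B)"
    "concat B ! (length (concat (take i B)) + k) = B ! i ! k"
    using assms(2) by (simp_all add: nth_append)
qed

definition member_upto :: "nat \<Rightarrow> 'a state \<Rightarrow> bool" where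
  "member_upto i s \<longleftrightarrow> (\<forall>t<N. \<forall>u<n. warr s 6 (t * n + u) = of_bool (t < i \<and> u \<in> bag B t))"

lemma wp_membership_bag:
  assumes s: "inputs s" "member_upto i s" and i: "wreg s 4 = i" "i < N"
    and pos: "wreg s 5 = length (concat (take i B))"
  shows "wp W membership_bag s (\<lambda>t s'. t \<le> sz * 30 + 10 \<and> member_upto (Suc i) s' \<and>
    wreg s' 5 = length (concat (take (Suc i) B)))"
proof -
  let ?l = "length (B ! i)"
  have l: "?l \<le> length (concat B)"
  proof (cases ?l)
    case (Suc k)
    then show ?thesis using concat_nth_bag(1)[OF i(2), of k] by simp
  qed simp
  show ?thesis
    unfolding membership_bag_def
  proof (rule wp_For[where n = ?l and T = 15 and I = "\<lambda>k s'.
      wreg s' 5 = length (concat (take i B)) + k \<and>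
      (\<forall>t<N. \<forall>u<n. warr s' 6 (t * n + u) =
        of_bool (t < i \<and> u \<in> bag B t \<or> t = i \<and> u \<in> set (take k (B ! i))))"], goal_cases)
    case 1
    show ?case using word_less[of ?l] l sz_ge(4) by simp
  next
    case (3 k s')
    then show ?case using s i by (simp add: frame_def inputs_def)
  next
    case 4
    then show ?case using s pos by (simp add: member_upto_def)
  next
    case (5 k s')
    define x where "x = B ! i ! k"
    have x: "warr s' 5 (wreg s' 5) = x" "wreg s' 4 = i" "wreg s' 0 = n"
      using 5 s i concat_nth_bag[OF i(2) 5(1)] by (simp_all add: frame_def inputs_def x_def)
    have "x \<in> bag B i" using 5(1) by (auto simp: x_def bag_def)
    then have xn: "x < n" using bag_subset[OF i(2)] by (auto simp: verts_def)
    have c: "i * n + x < 2 ^ W" using cell_word xn i sz_ge(3) by auto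
    have set: "set (take (Suc k) (B ! i)) = insert x (set (take k (B ! i)))"
      using 5(1) by (simp add: take_Suc_conv_app_nth x_def)
    have p: "Suc (length (concat (take i B)) + k) < 2 ^ W"
      using word_less concat_nth_bag(1)[OF i(2) 5(1)] sz_ge(4) by simp
    show ?case using 5(2,3) x c xn i(2) p
      by (auto simp: wval_cell cell_inj set)
  next
    case (6 t s')
    have "?l * 25 \<le> sz * 25" using l sz_ge(4) by simp
    then show ?case using 6 i
      by (auto simp: member_upto_def bag_def take_Suc_conv_app_nth less_Suc_eq)
  qed simp
qed

lemma wp_membership:
  assumes s: "inputs s" and zero: "warr s 6 = (\<lambda>_. 0)"
  shows "wp W membership s (\<lambda>t s'. t \<le> N * (sz * 30 + 30) + 10 \<and> member_upto N s')"
  unfolding membership_def wp_Seq wp_atomic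
proof (rule wp_For[where n = N and T = "sz * 30 + 10" and I = "\<lambda>i s'. member_upto i s' \<and>
    wreg s' 5 = length (concat (take i B))"], goal_cases)
  case 1
  show ?case using word_less[OF sz_ge(3)] by simp
next
  case 2
  show ?case by (simp add: membership_bag_def)
next
  case (3 i s')
  then show ?case using s by (simp add: frame_def inputs_def membership_bag_def)
next
  case 4
  show ?case using zero by (simp add: member_upto_def)
next
  case (5 i s')
  have "inputs s'" using 5(4) s by (simp add: frame_def inputs_def membership_bag_def)
  from wp_membership_bag[OF this _ 5(3,1)] 5(2) show ?case
    by (auto simp: member_upto_def elim!: wp_mono)
next
  case (6 t s')
  then show ?case by (simp add: algebra_simps)
qed

end

section \<open>The elimination algorithm\<close>

text \<open>In the search, register 7 is the candidate vertex, 8 its candidate bag, 9 a bag compared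
  with it and 10 a vertex of that bag. Flag 11 is cleared by a remaining vertex that the candidate
  bag lacks. Hits go to registers 5 and 6; as \<open>For\<close> has no early exit, the last hit
  wins.\<close>

definition test_bag :: com where
  "test_bag = For 10 (WReg 0) (If_then
     (BAnd (WEq (WLoad 7 (WReg 10)) (WConst 0))
       (BAnd (WEq (WLoad 6 (cell (WReg 9) (WReg 10))) (WConst 1))
             (WEq (WLoad 6 (cell (WReg 8) (WReg 10))) (WConst 0))))
     (WSet 11 (WConst 0)))"

definition test_bags :: com where
  "test_bags = For 9 (WReg 3)
     (If_then (WEq (WLoad 6 (cell (WReg 9) (WReg 7))) (WConst 1)) test_bag)"

definition test_vertex :: com where
  "test_vertex = For 8 (WReg 3)
     (If_then (WEq (WLoad 6 (cell (WReg 8) (WReg 7))) (WConst 1))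
       (Seq (WSet 11 (WConst 1)) (Seq test_bags
         (If_then (WEq (WReg 11) (WConst 1))
           (Seq (WSet 5 (WReg 7)) (WSet 6 (WReg 8)))))))"

definition find_vertex :: com where
  "find_vertex = For 7 (WReg 0) (If_then (WEq (WLoad 7 (WReg 7)) (WConst 0)) test_vertex)"

text \<open>Register 7 is doubled for each member, so it ends as the number of table entries and
  serves as the loop bound of \<open>make_table\<close>.\<close>

definition make_scope :: com where
  "make_scope = Seq (WSet 7 (WConst 1)) (For 8 (WReg 0)
     (Cond (BAnd (BNot (WEq (WReg 8) (WReg 5)))
             (BAnd (WEq (WLoad 7 (WReg 8)) (WConst 0))
                   (WEq (WLoad 6 (cell (WReg 6) (WReg 8))) (WConst 1))))
       (Seq (WStore 8 (cell (WReg 5) (WReg 8)) (WConst 1))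
            (WSet 7 (WOp WMul (WReg 7) (WConst 2))))
       (WStore 8 (cell (WReg 5) (WReg 8)) (WConst 0))))"

text \<open>The bits of the table index are peeled off in increasing order of the vertices, which is
  the order of ranks used by \<open>code\<close>. Vertices outside the scope get side 0.\<close>

definition decode_sides :: com where
  "decode_sides = Seq (WSet 10 (WReg 8)) (For 11 (WReg 0)
     (Cond (WEq (WLoad 8 (cell (WReg 5) (WReg 11))) (WConst 1))
       (Seq (WStore 9 (WReg 11) (WOp WMod (WReg 10) (WConst 2)))
            (WSet 10 (WOp WDiv (WReg 10) (WConst 2))))
       (WStore 9 (WReg 11) (WConst 0))))"

definition encode_sides :: com where
  "encode_sides = Seq (WSet 12 (WConst 0)) (Seq (WSet 13 (WConst 1)) (For 14 (WReg 0)
     (If_then (WEq (WLoad 8 (cell (WReg 11) (WReg 14))) (WConst 1))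
       (Seq (WSet 12 (WOp WAdd (WReg 12) (WOp WMul (WLoad 9 (WReg 14)) (WReg 13))))
            (WSet 13 (WOp WMul (WReg 13) (WConst 2)))))))"

text \<open>The language has no disjunction; the nested negations select \<open>v\<close> itself,
  for its loops, and the vertices of its scope.\<close>

definition star_loop :: com where
  "star_loop = Seq (NSet 2 NOne) (For 11 (WReg 0) (If_then
     (BAnd (BNot (BAnd (BNot (WEq (WReg 11) (WReg 5)))
                       (BNot (WEq (WLoad 8 (cell (WReg 5) (WReg 11))) (WConst 1)))))
           (WEq (WLoad 9 (WReg 11)) (WLoad 9 (WReg 5))))
     (NSet 2 (NOp NMul (NReg 2) (NLoad 0 (cell (WReg 5) (WReg 11)))))))"

definition factor_loop :: com where
  "factor_loop = For 11 (WReg 0) (If_then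
     (BAnd (WEq (WLoad 7 (WReg 11)) (WConst 1))
           (WEq (WLoad 8 (cell (WReg 11) (WReg 5))) (WConst 1)))
     (Seq encode_sides
          (NSet 2 (NOp NMul (NReg 2) (NLoad 1 (cell (WReg 12) (WReg 11)))))))"

definition sum_sides :: com where
  "sum_sides = For 9 (WConst 2)
     (Seq decode_sides (Seq (WStore 9 (WReg 5) (WReg 9))
     (Seq star_loop (Seq factor_loop (NSet 3 (NOp NAdd (NReg 3) (NReg 2)))))))"

definition make_table :: com where
  "make_table = For 8 (WReg 7) (Seq (NSet 3 NZero) (Seq sum_sides
     (NStore 1 (cell (WReg 8) (WReg 5)) (NReg 3))))"

definition mark :: com where
  "mark = Seq (For 7 (WReg 0) (If_then
     (BAnd (WEq (WLoad 7 (WReg 7)) (WConst 1))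
           (WEq (WLoad 8 (cell (WReg 7) (WReg 5))) (WConst 1)))
     (WStore 7 (WReg 7) (WConst 2))))
     (WStore 7 (WReg 5) (WConst 1))"

definition eliminate :: com where
  "eliminate = For 4 (WReg 0)
     (Seq find_vertex (Seq make_scope (Seq make_table mark)))"

text \<open>Precomputed write sets let frame facts be used while the subprograms stay
  folded.\<close>

lemma mods_find [simp]:
  "wregs_of test_bag = {10, 11}" "warrs_of test_bag = {}" "nregs_of test_bag = {}" "narrs_of test_bag = {}"
  "wregs_of test_bags = {9, 10, 11}" "warrs_of test_bags = {}" "nregs_of test_bags = {}" "narrs_of test_bags = {}"
  "wregs_of test_vertex = {5, 6, 8, 9, 10, 11}" "warrs_of test_vertex = {}"
  "nregs_of test_vertex = {}" "narrs_of test_vertex = {}"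
  "wregs_of find_vertex = {5, 6, 7, 8, 9, 10, 11}" "warrs_of find_vertex = {}"
  "nregs_of find_vertex = {}" "narrs_of find_vertex = {}"
  by (auto simp: test_bag_def test_bags_def test_vertex_def find_vertex_def)

lemma mods_table [simp]:
  "wregs_of make_scope = {7, 8}" "warrs_of make_scope = {8}" "nregs_of make_scope = {}" "narrs_of make_scope = {}"
  "wregs_of decode_sides = {10, 11}" "warrs_of decode_sides = {9}"
  "nregs_of decode_sides = {}" "narrs_of decode_sides = {}"
  "wregs_of encode_sides = {12, 13, 14}" "warrs_of encode_sides = {}"
  "nregs_of encode_sides = {}" "narrs_of encode_sides = {}"
  "wregs_of star_loop = {11}" "warrs_of star_loop = {}" "nregs_of star_loop = {2}" "narrs_of star_loop = {}"
  "wregs_of factor_loop = {11, 12, 13, 14}" "warrs_of factor_loop = {}"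
  "nregs_of factor_loop = {2}" "narrs_of factor_loop = {}"
  "wregs_of sum_sides = {9, 10, 11, 12, 13, 14}" "warrs_of sum_sides = {9}"
  "nregs_of sum_sides = {2, 3}" "narrs_of sum_sides = {}"
  "wregs_of make_table = {8, 9, 10, 11, 12, 13, 14}" "warrs_of make_table = {9}"
  "nregs_of make_table = {2, 3}" "narrs_of make_table = {1}"
  "wregs_of mark = {7}" "warrs_of mark = {7}" "nregs_of mark = {}" "narrs_of mark = {}"
  by (auto simp: make_scope_def decode_sides_def encode_sides_def star_loop_def factor_loop_def
      sum_sides_def make_table_def mark_def)

context tutte_input
begin

lemma n_word: "n < 2 ^ W" and N_word: "N < 2 ^ W"
  using word_less[OF sz_ge(1)] word_less[OF sz_ge(3)] by simp_all

lemma vertex_cell_word: "x < n \<Longrightarrow> y < n \<Longrightarrow> x * n + y < 2 ^ W"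
  using cell_word sz_ge(1) by simp

lemma bag_cell_word: "t < N \<Longrightarrow> y < n \<Longrightarrow> t * n + y < 2 ^ W"
  using cell_word sz_ge(3) by simp

definition rest :: "'a state \<Rightarrow> nat set" where
  "rest s = {v. v < n \<and> warr s 7 v = 0}"

definition alive :: "'a state \<Rightarrow> nat set" where
  "alive s = {v. v < n \<and> warr s 7 v = 1}"

definition scope :: "'a state \<Rightarrow> nat \<Rightarrow> nat set" where
  "scope s j = {u. u < n \<and> warr s 8 (j * n + u) = 1}"

text \<open>\<open>code\<close> sees only the part of \<open>S\<close> inside the scope, so a factor
  depends on its scope alone by construction.\<close>

definition factor :: "'a state \<Rightarrow> nat \<Rightarrow> nat set \<Rightarrow> 'a" where
  "factor s j S = narr s 1 (code (scope s j) n S * n + j)"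

text \<open>\<open>v\<close> is simplicial in the graph that joins remaining vertices sharing a bag,
  and \<open>t\<close> witnesses this. The condition mentions bags only, so it can be tested without
  following the tree.\<close>

definition eliminable :: "nat set \<Rightarrow> nat \<Rightarrow> nat \<Rightarrow> bool" where
  "eliminable R v t \<longleftrightarrow> v \<in> R \<and> t < N \<and> v \<in> bag B t \<and> (\<forall>s<N. v \<in> bag B s \<longrightarrow> bag B s \<inter> R \<subseteq> bag B t)"

lemma member_uptoD: "member_upto N s \<Longrightarrow> t < N \<Longrightarrow> u < n \<Longrightarrow> warr s 6 (t * n + u) = of_bool (u \<in> bag B t)"
  by (simp add: member_upto_def)

lemma ex_eliminable:
  assumes "R \<noteq> {}" "R \<subseteq> verts G"
  shows "\<exists>v t. eliminable R v t"
proof -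
  have "tree_decomposition G N (set F) (bag B)" using td by (simp add: encodes_tree_decomposition_def)
  then have t: "is_tree {..<N} (set F)" "(\<Union>t<N. bag B t) = verts G"
    "\<forall>v \<in> verts G. connected_on {t. t < N \<and> v \<in> bag B t} (set F)"
    by (auto simp: tree_decomposition_def)
  have "\<exists>v\<in>R. \<exists>t\<in>{..<N}. v \<in> bag B t \<and> (\<forall>s\<in>{..<N}. v \<in> bag B s \<longrightarrow> bag B s \<inter> R \<subseteq> bag B t)"
    using t assms by (intro exists_eliminable[where F = "set F"]) (auto simp: is_tree_def)
  then show ?thesis unfolding eliminable_def by blast
qed

section \<open>Correctness of the search for an eliminable vertex\<close>

lemma wp_test_bag:
  assumes s: "inputs s" "member_upto N s" and r: "wreg s 8 < N" "wreg s 9 < N"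
  shows "wp W test_bag s (\<lambda>t s'. t \<le> n * 60 + 10 \<and>
    wreg s' 11 = (if bag B (wreg s 9) \<inter> rest s \<subseteq> bag B (wreg s 8) then wreg s 11 else 0))"
  unfolding test_bag_def
proof (rule wp_For[where n = n and T = 40 and I = "\<lambda>i s'. wreg s' 11 =
      (if \<exists>u<i. u \<in> bag B (wreg s 9) \<and> u \<in> rest s \<and> u \<notin> bag B (wreg s 8) then 0 else wreg s 11)"], goal_cases)
  case (5 i s')
  have w: "wreg s' 0 = n" "wreg s' 8 = wreg s 8" "wreg s' 9 = wreg s 9" "wreg s' 10 = i"
    "warr s' 7 = warr s 7" "warr s' 6 = warr s 6"
    using 5(3,4) s by (simp_all add: frame_def inputs_def)
  show ?case using 5(1,2) w r bag_cell_word member_uptoD[OF s(2)]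
    by (auto simp: wval_cell rest_def less_Suc_eq)
next
  case (6 t s')
  have "(\<exists>u<n. u \<in> bag B (wreg s 9) \<and> u \<in> rest s \<and> u \<notin> bag B (wreg s 8)) \<longleftrightarrow>
      \<not> bag B (wreg s 9) \<inter> rest s \<subseteq> bag B (wreg s 8)" by (auto simp: rest_def)
  then show ?case using 6 by simp
qed (use n_word s in \<open>auto simp: frame_def inputs_def\<close>)

lemma wp_test_bags:
  assumes s: "inputs s" "member_upto N s" and r: "wreg s 8 < N" "wreg s 7 < n" "wreg s 11 = 1"
  shows "wp W test_bags s (\<lambda>t s'. t \<le> N * (n * 60 + 50) + 10 \<and>
    wreg s' 11 = of_bool (\<forall>t<N. wreg s 7 \<in> bag B t \<longrightarrow> bag B t \<inter> rest s \<subseteq> bag B (wreg s 8)))"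
proof -
  define P where "P t \<longleftrightarrow> bag B t \<inter> rest s \<subseteq> bag B (wreg s 8)" for t
  show ?thesis
    unfolding test_bags_def P_def[symmetric]
  proof (rule wp_For[where n = N and T = "n * 60 + 30" and I = "\<lambda>i s'. wreg s' 11 =
        of_bool (\<forall>t<i. wreg s 7 \<in> bag B t \<longrightarrow> P t)"], goal_cases)
    case (5 i s')
    have w: "wreg s' 0 = n" "wreg s' 8 = wreg s 8" "wreg s' 7 = wreg s 7" "wreg s' 9 = i"
      "warr s' 7 = warr s 7" "warr s' 6 = warr s 6" "inputs s'" "member_upto N s'" "rest s' = rest s"
      using 5(3,4) s by (simp_all add: frame_def inputs_def member_upto_def rest_def)
    have b: "wp W test_bag s' (\<lambda>t s''. t \<le> n * 60 + 10 \<and>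
        wreg s'' 11 = (if P i then wreg s' 11 else 0))"
      using wp_test_bag[OF w(7,8)] w r 5(1) by (simp add: P_def)
    show ?case
    proof (cases "wreg s 7 \<in> bag B i")
      case True
      then show ?thesis using 5(1,2) w r bag_cell_word member_uptoD[OF s(2)]
        by (auto simp: wval_cell less_Suc_eq intro!: wp_mono[OF b])
    next
      case False
      then show ?thesis using 5(1,2) w r bag_cell_word member_uptoD[OF s(2)]
        by (auto simp: wval_cell less_Suc_eq)
    qed
  next
    case (6 t s')
    then show ?case by (simp add: algebra_simps)
  qed (use N_word s r in \<open>auto simp: frame_def inputs_def\<close>)
qed

text \<open>Registers 5 and 6 hold arbitrary values before the first hit. The implication states
  that a valid pair is never lost and that a hit at this vertex produces one, which is what the
  outer loop chains.\<close>

lemma wp_test_vertex: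
  assumes s: "inputs s" "member_upto N s" and r: "wreg s 7 \<in> rest s"
  shows "wp W test_vertex s (\<lambda>t s'. t \<le> N * (N * (n * 60 + 50) + 100) + 10 \<and>
    (eliminable (rest s) (wreg s 5) (wreg s 6) \<or> (\<exists>t. eliminable (rest s) (wreg s 7) t) \<longrightarrow>
      eliminable (rest s) (wreg s' 5) (wreg s' 6)))"
  unfolding test_vertex_def
proof (rule wp_For[where n = N and T = "N * (n * 60 + 50) + 60" and I = "\<lambda>i s'.
      eliminable (rest s) (wreg s 5) (wreg s 6) \<or> (\<exists>t<i. eliminable (rest s) (wreg s 7) t) \<longrightarrow>
      eliminable (rest s) (wreg s' 5) (wreg s' 6)"], goal_cases)
  case (5 i s')
  have w: "wreg s' 0 = n" "wreg s' 8 = i" "wreg s' 7 = wreg s 7"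
    "warr s' 7 = warr s 7" "warr s' 6 = warr s 6"
    using 5(3,4) s by (simp_all add: frame_def inputs_def)
  have r': "wreg s 7 < n" using r by (simp add: rest_def)
  define s1 where "s1 = s'\<lparr>wreg := (wreg s')(11 := Suc 0)\<rparr>"
  have w1: "inputs s1" "member_upto N s1" "rest s1 = rest s" "wreg s1 8 = i" "wreg s1 7 = wreg s 7" "wreg s1 11 = 1"
    "wreg s1 5 = wreg s' 5" "wreg s1 6 = wreg s' 6"
    using 5(3,4) s by (simp_all add: frame_def inputs_def member_upto_def rest_def s1_def)
  have b: "wp W test_bags s1 (\<lambda>t s''. t \<le> N * (n * 60 + 50) + 10 \<and>
      wreg s'' 11 = of_bool (\<forall>t<N. wreg s 7 \<in> bag B t \<longrightarrow> bag B t \<inter> rest s \<subseteq> bag B i) \<and>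
      wreg s'' 5 = wreg s' 5 \<and> wreg s'' 6 = wreg s' 6 \<and> wreg s'' 7 = wreg s 7 \<and> wreg s'' 8 = i)"
    by (rule wp_frame[OF wp_test_bags]) (use w1 5(1) r' in \<open>auto simp: frame_def\<close>)
  have el: "eliminable (rest s) (wreg s 7) i \<longleftrightarrow> wreg s 7 \<in> bag B i \<and>
      (\<forall>t<N. wreg s 7 \<in> bag B t \<longrightarrow> bag B t \<inter> rest s \<subseteq> bag B i)"
    using r 5(1) by (simp add: eliminable_def)
  show ?case
  proof (cases "wreg s 7 \<in> bag B i")
    case True
    then have el': "eliminable (rest s) (wreg s 7) i \<longleftrightarrow>
      (\<forall>t<N. wreg s 7 \<in> bag B t \<longrightarrow> bag B t \<inter> rest s \<subseteq> bag B i)" using el by simp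
    have "warr s 6 (i * n + wreg s 7) = 1" using member_uptoD[OF s(2) 5(1) r'] True by simp
    then show ?thesis
      using w bag_cell_word[OF 5(1) r']
      by (simp add: wval_cell s1_def[symmetric], intro wp_mono[OF b[folded el']])
        (use 5(2) in \<open>auto simp: less_Suc_eq\<close>)
  next
    case False
    then have "\<not> eliminable (rest s) (wreg s 7) i" using el by simp
    then show ?thesis using False 5(1,2) w r' bag_cell_word member_uptoD[OF s(2)]
      by (auto simp: wval_cell less_Suc_eq)
  qed
next
  case (6 t s')
  have "(\<exists>t. eliminable (rest s) (wreg s 7) t) \<longleftrightarrow> (\<exists>t<N. eliminable (rest s) (wreg s 7) t)"
    by (auto simp: eliminable_def)
  then show ?case using 6 by (simp add: algebra_simps)
qed (use N_word s r in \<open>auto simp: frame_def inputs_def\<close>)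

lemma wp_find_vertex:
  assumes s: "inputs s" "member_upto N s" and r: "rest s \<noteq> {}"
  shows "wp W find_vertex s (\<lambda>t s'. t \<le> n * (N * (N * (n * 60 + 50) + 100) + 50) + 10 \<and>
      eliminable (rest s) (wreg s' 5) (wreg s' 6))"
  unfolding find_vertex_def
proof (rule wp_For[where n = n and T = "N * (N * (n * 60 + 50) + 100) + 20" and I = "\<lambda>i s'.
      (\<exists>v<i. \<exists>t. eliminable (rest s) v t) \<longrightarrow> eliminable (rest s) (wreg s' 5) (wreg s' 6)"], goal_cases)
  case (5 i s')
  have w: "wreg s' 7 = i" "warr s' 7 = warr s 7" "inputs s'" "member_upto N s'" "rest s' = rest s"
    using 5(3,4) s by (simp_all add: frame_def inputs_def member_upto_def rest_def)
  show ?case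
  proof (cases "i \<in> rest s")
    case True
    then have "warr s 7 i = 0" by (simp add: rest_def)
    moreover have "wp W test_vertex s' (\<lambda>t s''. t \<le> N * (N * (n * 60 + 50) + 100) + 10 \<and>
      (eliminable (rest s) (wreg s' 5) (wreg s' 6) \<or> (\<exists>t. eliminable (rest s) i t) \<longrightarrow>
       eliminable (rest s) (wreg s'' 5) (wreg s'' 6)))"
      using wp_test_vertex[OF w(3,4)] w True by simp
    ultimately show ?thesis using 5(2) w by (auto simp: less_Suc_eq elim!: wp_mono)
  next
    case False
    then have "warr s 7 i \<noteq> 0" using 5(1) by (simp add: rest_def)
    moreover have "\<not> eliminable (rest s) i t" for t using False by (simp add: eliminable_def)
    ultimately show ?thesis using 5(2) w by (auto simp: less_Suc_eq)
  qed
next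
  case (6 t s')
  obtain v t' where "eliminable (rest s) v t'" using ex_eliminable[OF r] by (auto simp: rest_def verts_def)
  moreover have "v < n" using calculation by (simp add: eliminable_def rest_def)
  ultimately show ?case using 6 by (auto simp: algebra_simps)
qed (use n_word s r in \<open>auto simp: frame_def inputs_def\<close>)

section \<open>Correctness of scopes, codes and products over the star and the factors\<close>

lemma scope_less: "scope s j \<subseteq> {..<n}"
  by (auto simp: scope_def)

lemma card_Int_lessThan_le: "finite D \<Longrightarrow> card (D \<inter> {..<i}) \<le> card D" for D :: "nat set"
  by (intro card_mono) auto

lemma power_card_word:
  fixes D :: "nat set"
  assumes "0 < n" "card D \<le> Suc (width N (bag B))" "finite D"
  shows "(2::nat) ^ card (D \<inter> {..<i}) * 2 < 2 ^ W"
proof -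
  have "(2::nat) ^ card (D \<inter> {..<i}) \<le> bound"
    using assms card_Int_lessThan_le[OF assms(3), of i] by (intro power_increasing) auto
  moreover have "2 * bound \<le> 2 * bound * n" using assms(1) by simp
  ultimately show ?thesis using bound_word[OF assms(1)] by linarith
qed

lemma wp_make_scope:
  assumes s: "inputs s" "member_upto N s" and v: "wreg s 5 < n" and t: "wreg s 6 < N"
  shows "wp W make_scope s (\<lambda>t s'. t \<le> n * 80 + 20 \<and>
    scope s' (wreg s 5) = bag B (wreg s 6) \<inter> rest s - {wreg s 5} \<and>
    wreg s' 7 = 2 ^ card (bag B (wreg s 6) \<inter> rest s - {wreg s 5}) \<and>
    (\<forall>j<n. j \<noteq> wreg s 5 \<longrightarrow> scope s' j = scope s j))"
proof -
  define U where "U = bag B (wreg s 6) \<inter> rest s - {wreg s 5}"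
  have U: "U \<subseteq> {..<n}" by (auto simp: U_def rest_def)
  then have finU: "finite U" using finite_subset by blast
  have cardU: "card U \<le> Suc (width N (bag B))"
  proof -
    have "card U \<le> card (bag B (wreg s 6))" by (rule card_mono) (auto simp: U_def bag_def)
    then show ?thesis using card_bag[OF t] by simp
  qed
  show ?thesis
    unfolding make_scope_def wp_Seq wp_atomic U_def[symmetric]
  proof (rule wp_For[where n = n and T = 50 and I = "\<lambda>i s'. wreg s' 7 = 2 ^ card (U \<inter> {..<i}) \<and>
      (\<forall>j<n. \<forall>u<n. warr s' 8 (j * n + u) =
        (if j = wreg s 5 \<and> u < i then of_bool (u \<in> U) else warr s 8 (j * n + u)))"], goal_cases)
    case (5 i s')
    have w: "wreg s' 0 = n" "wreg s' 8 = i" "wreg s' 5 = wreg s 5" "wreg s' 6 = wreg s 6"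
      "warr s' 7 = warr s 7" "warr s' 6 = warr s 6"
      using 5(3,4) s by (simp_all add: frame_def inputs_def)
    have iU: "i \<in> U \<longleftrightarrow> i \<noteq> wreg s 5 \<and> warr s 7 i = 0 \<and> i \<in> bag B (wreg s 6)"
      using 5(1) by (auto simp: U_def rest_def)
    have pw: "2 ^ card (U \<inter> {..<i}) * 2 < (2::nat) ^ W"
      using power_card_word[OF _ cardU finU, of i] v by simp
    show ?case
    proof (cases "i \<in> U")
      case True
      then show ?thesis using 5(1,2) w pw bag_cell_word[OF t 5(1)] vertex_cell_word[OF v 5(1)]
          member_uptoD[OF s(2) t 5(1)] v iU
        by (auto simp: wval_cell cell_inj less_Suc_eq card_Int_lessThan_Suc)
    next
      case False
      then show ?thesis using 5(1,2) w bag_cell_word[OF t 5(1)] vertex_cell_word[OF v 5(1)]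
          member_uptoD[OF s(2) t 5(1)] v iU
        by (auto simp: wval_cell cell_inj less_Suc_eq card_Int_lessThan_Suc)
    qed
  next
    case (6 t s')
    have "U \<inter> {..<n} = U" using U by blast
    then show ?case using 6 v U by (auto simp: scope_def)
  qed (use n_word s in \<open>auto simp: frame_def inputs_def\<close>)
qed

definition sides :: "nat set \<Rightarrow> 'a state \<Rightarrow> bool" where
  "sides S s \<longleftrightarrow> (\<forall>u<n. warr s 9 u = of_bool (u \<in> S))"

lemma wp_decode_sides:
  assumes s: "inputs s" and v: "wreg s 5 < n"
  shows "wp W decode_sides s (\<lambda>t s'. t \<le> n * 60 + 20 \<and> sides (decode (scope s (wreg s 5)) (wreg s 8)) s')"
proof -
  define U where "U = scope s (wreg s 5)"
  define x where "x = wreg s 8"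
  show ?thesis
    unfolding decode_sides_def wp_Seq wp_atomic U_def[symmetric] x_def[symmetric]
  proof (rule wp_For[where n = n and T = 30 and I = "\<lambda>i s'. wreg s' 10 = x div 2 ^ card (U \<inter> {..<i}) \<and>
      (\<forall>u<i. warr s' 9 u = of_bool (u \<in> decode U x))"], goal_cases)
    case (5 i s')
    have w: "wreg s' 0 = n" "wreg s' 11 = i" "wreg s' 5 = wreg s 5" "warr s' 8 = warr s 8"
      using 5(3,4) s by (simp_all add: frame_def inputs_def)
    have iU: "i \<in> U \<longleftrightarrow> warr s 8 (wreg s 5 * n + i) = 1" using 5(1) by (simp add: U_def scope_def)
    have dec: "i \<in> decode U x \<longleftrightarrow> i \<in> U \<and> odd (x div 2 ^ card (U \<inter> {..<i}))"
      by (simp add: decode_def)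
    show ?case using 5(1,2) w vertex_cell_word[OF v 5(1)] iU
      by (auto simp: wval_cell less_Suc_eq card_Int_lessThan_Suc dec odd_iff_mod_2_eq_one
          even_iff_mod_2_eq_zero div_mult2_eq power_Suc2 simp del: power_Suc)
  next
    case (6 t s')
    then show ?case by (auto simp: sides_def)
  qed (use n_word s x_def in \<open>auto simp: frame_def inputs_def\<close>)
qed

text \<open>The second argument of \<open>code\<close> pays off here: \<open>code D i S\<close> is
  the partial sum after \<open>i\<close> vertices, and register 13 holds the place value of the next
  member of \<open>D\<close>.\<close>

lemma wp_encode_sides:
  assumes s: "inputs s" "sides S s" and j: "wreg s 11 < n"
    and card: "card (scope s (wreg s 11)) \<le> Suc (width N (bag B))"
  shows "wp W encode_sides s (\<lambda>t s'. t \<le> n * 60 + 20 \<and> wreg s' 12 = code (scope s (wreg s 11)) n S)"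
proof -
  define D where "D = scope s (wreg s 11)"
  have finD: "finite D" using finite_subset[OF scope_less] by (auto simp: D_def)
  show ?thesis
    unfolding encode_sides_def wp_Seq wp_atomic D_def[symmetric]
  proof (rule wp_For[where n = n and T = 30 and I = "\<lambda>i s'. wreg s' 12 = code D i S \<and>
      wreg s' 13 = 2 ^ card (D \<inter> {..<i})"], goal_cases)
    case (5 i s')
    have w: "wreg s' 0 = n" "wreg s' 14 = i" "wreg s' 11 = wreg s 11" "warr s' 8 = warr s 8" "warr s' 9 = warr s 9"
      using 5(3,4) s by (simp_all add: frame_def inputs_def)
    have iD: "i \<in> D \<longleftrightarrow> warr s 8 (wreg s 11 * n + i) = 1" using 5(1) by (simp add: D_def scope_def)
    have side: "warr s 9 i = of_bool (i \<in> S)" using s(2) 5(1) by (simp add: sides_def)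
    have pw: "2 ^ card (D \<inter> {..<i}) * 2 < (2::nat) ^ W"
      using power_card_word[OF _ card[folded D_def] finD, of i] j by simp
    have "code D i S + 2 ^ card (D \<inter> {..<i}) < 2 ^ W" using code_less[of D i S] pw by linarith
    moreover have "2 ^ card (D \<inter> {..<i}) mod 2 ^ W = (2::nat) ^ card (D \<inter> {..<i})"
      using pw by (intro mod_less) linarith
    moreover have "code D i S mod 2 ^ W = code D i S" using calculation(1) by simp
    ultimately show ?case using 5(1,2) w vertex_cell_word[OF j 5(1)] iD side pw
      by (auto simp: wval_cell card_Int_lessThan_Suc code_Suc)
  qed (use n_word s in \<open>auto simp: frame_def inputs_def code_def\<close>)
qed

definition weighted :: "'a state \<Rightarrow> bool" where
  "weighted s \<longleftrightarrow> (\<forall>u<n. \<forall>v<n. narr s 0 (u * n + v) = b ^ mult G u v)"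

lemma prod_Int_lessThan_Suc:
  fixes f :: "nat \<Rightarrow> 'b::comm_monoid_mult"
  shows "prod f (D \<inter> {..<Suc i}) = prod f (D \<inter> {..<i}) * (if i \<in> D then f i else 1)"
  by (auto simp: lessThan_Suc Int_insert_right mult.commute)

lemma wp_star_loop:
  assumes s: "inputs s" "sides S s" "weighted s" and v: "wreg s 5 < n"
  shows "wp W star_loop s (\<lambda>t s'. t \<le> n * 60 + 20 \<and>
    nreg s' 2 = star_prod G b (wreg s 5) (insert (wreg s 5) (scope s (wreg s 5))) S)"
proof -
  define v where "v = wreg s 5"
  define U where "U = insert v (scope s v)"
  have U: "U \<subseteq> {..<n}" using assms(4) scope_less by (auto simp: U_def v_def)
  show ?thesis
    unfolding star_loop_def wp_Seq wp_atomic v_def[symmetric] U_def[symmetric]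
  proof (rule wp_For[where n = n and T = 40 and I = "\<lambda>i s'.
      nreg s' 2 = star_prod G b v (U \<inter> {..<i}) S"], goal_cases)
    case (5 i s')
    have w: "wreg s' 0 = n" "wreg s' 11 = i" "wreg s' 5 = v" "warr s' 8 = warr s 8" "warr s' 9 = warr s 9"
      "narr s' = narr s"
      using 5(3,4) s by (auto simp: frame_def inputs_def v_def)
    have iU: "i \<in> U \<longleftrightarrow> i = v \<or> warr s 8 (v * n + i) = 1" using 5(1) by (auto simp: U_def scope_def)
    have side: "warr s 9 i = of_bool (i \<in> S)" "warr s 9 v = of_bool (v \<in> S)"
      using s(2) 5(1) assms(4) by (simp_all add: sides_def v_def)
    have wt: "narr s 0 (v * n + i) = b ^ mult G v i" using s(3) 5(1) assms(4) by (simp add: weighted_def v_def)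
    have c: "v * n + i < 2 ^ W" using vertex_cell_word[OF assms(4) 5(1)] by (simp add: v_def)
    show ?case
    proof (cases "i \<in> U \<and> (i \<in> S \<longleftrightarrow> v \<in> S)")
      case True
      then have "i = v \<or> warr s 8 (v * n + i) = 1" "i \<in> U" "(i \<in> S) = (v \<in> S)" using iU by auto
      then show ?thesis using 5(2) w c side wt
        by (auto simp: wval_cell star_prod_def prod_Int_lessThan_Suc)
    next
      case False
      then have "star_prod G b v (U \<inter> {..<Suc i}) S = star_prod G b v (U \<inter> {..<i}) S"
        by (auto simp: star_prod_def prod_Int_lessThan_Suc)
      then show ?thesis using False 5(2) w c side iU by (auto simp: wval_cell)
    qed
  next
    case (6 t s')
    have "U \<inter> {..<n} = U" using U by blast
    then show ?case using 6 by simp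
  qed (use n_word s in \<open>auto simp: frame_def inputs_def star_prod_def\<close>)
qed

lemma wp_factor_loop:
  assumes s: "inputs s" "sides S s" and v: "wreg s 5 < n"
    and card: "\<And>j. j \<in> alive s \<Longrightarrow> card (scope s j) \<le> Suc (width N (bag B))"
  shows "wp W factor_loop s (\<lambda>t s'. t \<le> n * (n * 60 + 100) + 20 \<and>
    nreg s' 2 = nreg s 2 * (\<Prod>j\<in>{j \<in> alive s. wreg s 5 \<in> scope s j}. factor s j S))"
proof -
  define v where "v = wreg s 5"
  define J where "J = {j \<in> alive s. v \<in> scope s j}"
  show ?thesis
    unfolding factor_loop_def v_def[symmetric] J_def[symmetric]
  proof (rule wp_For[where n = n and T = "n * 60 + 70" and I = "\<lambda>i s'.
      nreg s' 2 = nreg s 2 * (\<Prod>j\<in>J \<inter> {..<i}. factor s j S)"], goal_cases)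
    case (5 i s')
    have w: "wreg s' 0 = n" "wreg s' 11 = i" "wreg s' 5 = v" "warr s' 7 = warr s 7" "warr s' 8 = warr s 8"
      "narr s' = narr s" "inputs s'" "sides S s'" "scope s' = scope s"
      using 5(3,4) s by (auto simp: frame_def inputs_def v_def sides_def scope_def fun_eq_iff)
    have c: "i * n + v < 2 ^ W" using vertex_cell_word[OF 5(1)] assms(3) by (simp add: v_def)
    have iJ: "i \<in> J \<longleftrightarrow> warr s 7 i = 1 \<and> warr s 8 (i * n + v) = 1"
      using 5(1) assms(3) by (auto simp: J_def alive_def scope_def v_def)
    show ?case
    proof (cases "i \<in> J")
      case True
      then have ia: "i \<in> alive s" by (simp add: J_def)
      have "wp W encode_sides s' (\<lambda>t s''. t \<le> n * 60 + 20 \<and> wreg s'' 12 = code (scope s i) n S \<and>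
        wreg s'' 0 = n \<and> wreg s'' 11 = i \<and> narr s'' = narr s \<and> nreg s'' 2 = nreg s' 2)"
        by (rule wp_frame[OF wp_encode_sides[OF w(7,8)]])
          (use w 5(1) card[OF ia] in \<open>auto simp: frame_def fun_eq_iff\<close>)
      moreover have "code (scope s i) n S < bound"
      proof -
        have "code (scope s i) n S < 2 ^ card (scope s i \<inter> {..<n})" by (rule code_less)
        also have "scope s i \<inter> {..<n} = scope s i" using scope_less by blast
        also have "(2::nat) ^ card (scope s i) \<le> bound" using card[OF ia] by (intro power_increasing) auto
        finally show ?thesis .
      qed
      then have "code (scope s i) n S * n + i < 2 ^ W" using 5(1) by (rule table_word)
      ultimately show ?thesis using True iJ 5(2) w c
        by (auto simp: wval_cell prod_Int_lessThan_Suc factor_def elim!: wp_mono)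
    next
      case False
      then show ?thesis using iJ 5(2) w c
        by (auto simp: wval_cell prod_Int_lessThan_Suc)
    qed
  next
    case (6 t s')
    have "J \<inter> {..<n} = J" by (auto simp: J_def alive_def)
    then show ?case using 6 by (simp add: algebra_simps)
  qed (use n_word s in \<open>auto simp: frame_def inputs_def\<close>)
qed

end

text \<open>Once all scopes are empty, the value of factor \<open>v\<close> is at index
  \<open>0 * n + v\<close>. Dividing by \<open>b - 1\<close> at every vertex and by
  \<open>a - 1\<close> at every label that is its own representative yields both powers without
  computing exponents.\<close>

definition finish :: com where
  "finish = Seq (NSet 2 NOne) (Seq
     (For 4 (WReg 0)
       (Seq (If_then (WEq (WLoad 7 (WReg 4)) (WConst 1)) (NSet 2 (NOp NMul (NReg 2) (NLoad 1 (WReg 4)))))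
       (Seq (If_then (WEq (WLoad 10 (WReg 4)) (WReg 4))
              (NSet 2 (NOp NDiv (NReg 2) (NOp NSub (NReg 0) NOne))))
            (NSet 2 (NOp NDiv (NReg 2) (NOp NSub (NReg 1) NOne))))))
     (NSet 0 (NReg 2)))"

definition tutte_program :: com where
  "tutte_program = Seq weights (Seq labels (Seq membership (Seq eliminate finish)))"

lemma mods_program [simp]:
  "wregs_of weights = {4}" "warrs_of weights = {}" "nregs_of weights = {}" "narrs_of weights = {0}"
  "wregs_of labels = {4, 5, 6, 7}" "warrs_of labels = {10}" "nregs_of labels = {}" "narrs_of labels = {}"
  "wregs_of membership = {4, 5, 6}" "warrs_of membership = {6}"
  "nregs_of membership = {}" "narrs_of membership = {}"
  "wregs_of eliminate = {4, 5, 6, 7, 8, 9, 10, 11, 12, 13, 14}" "warrs_of eliminate = {7, 8, 9}"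
  "nregs_of eliminate = {2, 3}" "narrs_of eliminate = {1}"
  by (auto simp: weights_def weights_loop_def labels_def labels_loop_def relabel_def
      membership_def membership_bag_def eliminate_def)

lemma message_cong:
  assumes "\<And>j. j \<in> J \<Longrightarrow> f j S = f' j S"
  shows "message G b v U J f S = message G b v U J f' S"
  using assms by (simp add: message_def)

lemma decode_subset: "decode D x \<subseteq> D"
  by (auto simp: decode_def)

context tutte_input
begin

section \<open>One elimination round and its invariant\<close>

definition static :: "'a state \<Rightarrow> 'a state \<Rightarrow> bool" where
  "static s s' \<longleftrightarrow> inputs s' \<and> weighted s' \<and> wreg s' 5 = wreg s 5 \<and> wreg s' 8 = wreg s 8 \<and>
     scope s' = scope s \<and> alive s' = alive s \<and> factor s' = factor s"

text \<open>The subprograms that fill a table write only scratch memory, so a check of write sets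
  carries all relevant data through them.\<close>

lemma static_frame:
  assumes st: "static s s1" and fr: "frame c s1 s2"
    and "{0, 1, 3, 5, 8} \<inter> wregs_of c = {}" "{0, 1, 4, 5, 7, 8} \<inter> warrs_of c = {}"
    and "{0, 1} \<inter> nregs_of c = {}" "{0, 1} \<inter> narrs_of c = {}"
  shows "static s s2"
proof -
  have "wreg s2 r = wreg s1 r" if "r \<in> {0, 1, 3, 5, 8}" for r
    using fr assms(3) that unfolding frame_def by blast
  moreover have "warr s2 r = warr s1 r" if "r \<in> {0, 1, 4, 5, 7, 8}" for r
    using fr assms(4) that unfolding frame_def by blast
  moreover have "nreg s2 r = nreg s1 r" if "r \<in> {0, 1}" for r
    using fr assms(5) that unfolding frame_def by blast
  moreover have "narr s2 r = narr s1 r" if "r \<in> {0, 1}" for r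
    using fr assms(6) that unfolding frame_def by blast
  ultimately show ?thesis
    using st by (auto simp: static_def inputs_def weighted_def scope_def alive_def factor_def fun_eq_iff)
qed

text \<open>The loop counter is itself the side of \<open>v\<close>. Since \<open>v\<close> is not
  in its own scope, decoding leaves it on side 0, and the counter then overwrites that entry;
  \<open>S i\<close> is the resulting vertex set.\<close>

lemma wp_sum_sides:
  assumes s: "inputs s" "weighted s" and v: "wreg s 5 < n" "wreg s 5 \<notin> scope s (wreg s 5)"
    and card: "\<And>j. j \<in> alive s \<Longrightarrow> card (scope s j) \<le> Suc (width N (bag B))"
    and zero: "nreg s 3 = 0"
    and U: "U = scope s (wreg s 5)" and J: "J = {j \<in> alive s. wreg s 5 \<in> scope s j}"
    and D: "D = decode U (wreg s 8)"
  shows "wp W sum_sides s (\<lambda>t s'. t \<le> n * (n * 120 + 440) + 250 \<and>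
    nreg s' 3 = message G b (wreg s 5) U J (factor s) D +
      message G b (wreg s 5) U J (factor s) (insert (wreg s 5) D))"
proof -
  let ?v = "wreg s 5"
  define S where "S i = (if i = (1::nat) then insert ?v D else D)" for i
  let ?m = "message G b ?v U J (factor s)"
  show ?thesis
    unfolding sum_sides_def
  proof (rule wp_For[where n = 2 and T = "n * (n * 60 + 220) + 90" and
        I = "\<lambda>i s'. nreg s' 3 = (\<Sum>k<i. ?m (S k))"], goal_cases)
    case (5 i s')
    have st: "static s s'"
      using s by (intro static_frame[OF _ 5(4)]) (auto simp: static_def)
    have i: "wreg s' 9 = i" using 5(3) by simp
    show ?case
      unfolding wp_Seq wp_atomic
    proof (rule wp_frame[OF wp_decode_sides], goal_cases)
      case (3 t1 s1)
      have st1: "static s s1" using st 3(2) by (rule static_frame) auto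
      define s2 where "s2 = s1\<lparr>warr := (warr s1)(9 := (warr s1 9)(?v := i))\<rparr>"
      have st2: "static s s2" using st1
        by (auto simp: static_def s2_def inputs_def weighted_def scope_def alive_def factor_def fun_eq_iff)
      have i1: "wreg s1 9 = i" "nreg s1 3 = nreg s' 3" using 3(2) i by (auto simp: frame_def)
      have "sides D s1" using 3(1) st by (simp add: D U static_def)
      moreover have "?v \<notin> D" using decode_subset v(2) by (auto simp: D U)
      ultimately have sides2: "sides (S i) s2"
        using 5(1) v(1) by (auto simp: sides_def s2_def S_def)
      have s2_eq: "s1\<lparr>warr := (warr s1)(9 := (warr s1 9)(wval W s1 (WReg 5) := wval W s1 (WReg 9)))\<rparr> = s2"
        using st1 i1 by (simp add: s2_def static_def)
      have r2: "nreg s2 3 = nreg s' 3" using i1 by (simp add: s2_def)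
      show ?case
        unfolding s2_eq
      proof (rule wp_frame[OF wp_star_loop[OF _ sides2]], goal_cases)
        case (4 t3 s3)
        have st3: "static s s3" using st2 4(2) by (rule static_frame) auto
        have sides3: "sides (S i) s3" using sides2 4(2) by (simp add: sides_def frame_def)
        have r3: "nreg s3 3 = nreg s' 3" using r2 4(2) by (simp add: frame_def)
        show ?case
        proof (rule wp_frame[OF wp_factor_loop[OF _ sides3]], goal_cases)
          case (4 t4 s4)
          have r4: "nreg s4 3 = nreg s' 3" using r3 4(2) by (simp add: frame_def)
          have "nreg s4 2 = ?m (S i)"
            using 4(1) \<open>t3 \<le> _ \<and> _\<close> st3 st2 by (simp add: static_def message_def U J)
          then show ?case
            using r4 5(2) 3(1) \<open>t3 \<le> _ \<and> _\<close> 4(1) by (simp add: algebra_simps)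
        qed (use st3 v card in \<open>auto simp: static_def\<close>)
      qed (use st2 v in \<open>auto simp: static_def\<close>)
    qed (use st v in \<open>auto simp: static_def\<close>)
  next
    case (6 t s')
    have "(\<Sum>k<2. ?m (S k)) = ?m D + ?m (insert ?v D)"
      by (simp add: S_def eval_nat_numeral)
    then show ?case using 6(1,2) by (simp add: algebra_simps)
  qed (use two_word zero in auto)
qed

lemma wp_make_table:
  assumes s: "inputs s" "weighted s" and v: "wreg s 5 < n" "wreg s 5 \<notin> scope s (wreg s 5)"
    and dead: "wreg s 5 \<notin> alive s"
    and card: "\<And>j. j \<in> alive s \<Longrightarrow> card (scope s j) \<le> Suc (width N (bag B))"
    and U: "U = scope s (wreg s 5)" and J: "J = {j \<in> alive s. wreg s 5 \<in> scope s j}"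
    and cardU: "card U \<le> Suc (width N (bag B))" and pw: "wreg s 7 = 2 ^ card U"
  shows "wp W make_table s (\<lambda>t s'. t \<le> bound * (n * (n * 120 + 440) + 300) + 10 \<and>
    (\<forall>S. factor s' (wreg s 5) S = message G b (wreg s 5) U J (factor s) (S \<inter> U) +
      message G b (wreg s 5) U J (factor s) (insert (wreg s 5) (S \<inter> U))) \<and>
    (\<forall>j<n. j \<noteq> wreg s 5 \<longrightarrow> factor s' j = factor s j))"
proof -
  let ?v = "wreg s 5"
  let ?m = "message G b ?v U J (factor s)"
  let ?M = "\<lambda>x. ?m (decode U x) + ?m (insert ?v (decode U x))"
  have b: "2 ^ card U \<le> bound" using cardU by (intro power_increasing) auto
  have Un: "U \<subseteq> {..<n}" using scope_less by (simp add: U)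
  have w: "2 * bound \<le> 2 * bound * n" "2 * bound * n < 2 ^ W" using bound_word v(1) by auto
  show ?thesis
    unfolding make_table_def
  proof (rule wp_For[where n = "2 ^ card U" and T = "n * (n * 120 + 440) + 270" and
        I = "\<lambda>i s'. (\<forall>x<i. narr s' 1 (x * n + ?v) = ?M x) \<and>
          (\<forall>x. \<forall>j<n. j \<noteq> ?v \<longrightarrow> narr s' 1 (x * n + j) = narr s 1 (x * n + j))"], goal_cases)
    case 1
    show ?case using b w by linarith
  next
    case (3 i s')
    then show ?case using pw by (simp add: frame_def)
  next
    case (5 i s')
    have fr: "inputs s'" "weighted s'" "wreg s' 5 = ?v" "scope s' = scope s" "alive s' = alive s"
      "wreg s' 8 = i" "wreg s' 0 = n"
      using 5(3,4) s by (auto simp: frame_def inputs_def weighted_def scope_def alive_def fun_eq_iff)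
    \<comment> \<open>The table under construction overwrites column \<open>v\<close>, while the
      factors being read are alive; \<open>v\<close> is not, so no column is read and written at
      once.\<close>
    have fac: "factor s' j = factor s j" if "j \<in> J" for j
    proof -
      have "j < n" "j \<noteq> ?v" using that dead by (auto simp: J alive_def)
      then show ?thesis using 5(2) fr by (simp add: factor_def fun_eq_iff)
    qed
    define s1 where "s1 = s'\<lparr>nreg := (nreg s')(3 := 0)\<rparr>"
    have s1: "inputs s1" "weighted s1" "wreg s1 5 = ?v" "scope s1 = scope s" "alive s1 = alive s"
      "wreg s1 8 = i" "nreg s1 3 = 0" "factor s1 = factor s'" "narr s1 = narr s'" "wreg s1 0 = n"
      using fr by (auto simp: s1_def inputs_def weighted_def scope_def alive_def factor_def fun_eq_iff)
    have mm: "message G b ?v U J (factor s1) S = ?m S" for S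
      using fac s1(8) by (intro message_cong) auto
    have c: "i * n + ?v < 2 ^ W" using 5(1) b v(1) by (intro table_word) auto
    have "wp W sum_sides s1 (\<lambda>t s''. t \<le> n * (n * 120 + 440) + 250 \<and> nreg s'' 3 = ?M i \<and>
        narr s'' = narr s' \<and> wreg s'' 0 = n \<and> wreg s'' 5 = ?v \<and> wreg s'' 8 = i)"
    proof (rule wp_frame[OF wp_sum_sides[where U = U and J = J and D = "decode U i"]], goal_cases)
      case (10 t s'')
      then show ?case using mm s1 by (simp add: frame_def fun_eq_iff)
    qed (use s1 v card in \<open>auto simp: U J\<close>)
    then show ?case
      unfolding wp_Seq wp_atomic nval.simps s1_def[symmetric]
      by (rule wp_mono) (use 5(2) c v(1) in \<open>auto simp: wval_cell less_Suc_eq cell_inj\<close>)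
  next
    case (6 t s')
    have sc: "scope s' = scope s" using 6(4) by (simp add: frame_def scope_def fun_eq_iff)
    have "2 ^ card U * (n * (n * 120 + 440) + 270 + 1 + 7) \<le> bound * (n * (n * 120 + 440) + 300)"
      using b by (intro mult_mono) auto
    then have "t \<le> bound * (n * (n * 120 + 440) + 300) + 10" using 6(1) by simp
    moreover have "factor s' ?v S = ?m (S \<inter> U) + ?m (insert ?v (S \<inter> U))" for S
    proof -
      \<comment> \<open>Every subset of \<open>U\<close> has a code below the loop bound, so the
        loop has filled each entry that can be looked up.\<close>
      have "code U n S < 2 ^ card (U \<inter> {..<n})" by (rule code_less)
      also have "U \<inter> {..<n} = U" using Un by blast
      finally have "narr s' 1 (code U n S * n + ?v) = ?M (code U n S)" using 6(2) by blast
      then show ?thesis using decode_code[OF Un] sc by (simp add: factor_def U)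
    qed
    moreover have "factor s' j = factor s j" if "j < n" "j \<noteq> ?v" for j
      using 6(2) that sc by (simp add: factor_def fun_eq_iff)
    ultimately show ?case by blast
  qed auto
qed

lemma wp_mark:
  assumes s: "inputs s" and v: "wreg s 5 \<in> rest s" and J: "J = {j \<in> alive s. wreg s 5 \<in> scope s j}"
  shows "wp W mark s (\<lambda>t s'. t \<le> n * 60 + 20 \<and> rest s' = rest s - {wreg s 5} \<and>
    alive s' = insert (wreg s 5) (alive s - J))"
proof -
  let ?v = "wreg s 5"
  have vn: "?v < n" "warr s 7 ?v = 0" using v by (auto simp: rest_def)
  show ?thesis
    unfolding mark_def wp_Seq
  proof (rule wp_For[where n = n and T = 40 and I = "\<lambda>i s'. \<forall>j<n. warr s' 7 j =
      (if j < i \<and> j \<in> J then 2 else warr s 7 j)"], goal_cases)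
    case (5 i s')
    have w: "wreg s' 0 = n" "wreg s' 7 = i" "wreg s' 5 = ?v" "warr s' 8 = warr s 8"
      using 5(3,4) s by (simp_all add: frame_def inputs_def)
    have iJ: "i \<in> J \<longleftrightarrow> warr s 7 i = 1 \<and> warr s 8 (i * n + ?v) = 1"
      using 5(1) vn by (auto simp: J alive_def scope_def)
    show ?case using 5(1,2) w iJ vertex_cell_word[OF 5(1) vn(1)]
      by (auto simp: wval_cell less_Suc_eq)
  next
    case (6 t s')
    have "wreg s' 5 = ?v" using 6(4) by (simp add: frame_def)
    moreover have "?v \<notin> J" using vn by (auto simp: J alive_def)
    ultimately show ?case using 6(1,2) vn by (auto simp: rest_def alive_def J split: if_splits)
  qed (use n_word s in \<open>auto simp: frame_def inputs_def\<close>)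
qed

text \<open>Scopes inside \<open>rest s\<close> make every factor constant once no vertex remains.
  Scopes inside bags bound the table sizes and let eliminability act on factors as it does on
  edges.\<close>

definition elim_inv :: "'a state \<Rightarrow> bool" where
  "elim_inv s \<longleftrightarrow> inputs s \<and> member_upto N s \<and> weighted s \<and>
     (\<forall>j\<in>alive s. scope s j \<subseteq> rest s \<and> (\<exists>t<N. scope s j \<subseteq> bag B t)) \<and>
     (\<Sum>S\<in>Pow (rest s). edge_prod G b (rest s) S * (\<Prod>j\<in>alive s. factor s j S)) = ising G b"

lemma bag_of_edge:
  assumes "e \<in> edges G"
  obtains t where "t < N" "fst (ends G ! e) \<in> bag B t" "snd (ends G ! e) \<in> bag B t"
proof -
  have "ends G ! e \<in> set (ends G)" using assms by (simp add: edges_def)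
  then show ?thesis using td that
    unfolding encodes_tree_decomposition_def tree_decomposition_def by fastforce
qed

lemma wp_eliminate_step:
  assumes inv: "elim_inv s" and ne: "rest s \<noteq> {}"
  shows "wp W (Seq find_vertex (Seq make_scope (Seq make_table mark))) s (\<lambda>t s'.
    t \<le> (n * (N * (N * (n * 60 + 50) + 100) + 50) + n * 140 + 60) + bound * (n * (n * 120 + 440) + 300) \<and>
    elim_inv s' \<and> card (rest s') = card (rest s) - 1)"
proof -
  have s: "inputs s" "member_upto N s" "weighted s"
    and sc: "\<And>j. j \<in> alive s \<Longrightarrow> scope s j \<subseteq> rest s" "\<And>j. j \<in> alive s \<Longrightarrow> \<exists>t<N. scope s j \<subseteq> bag B t"
    and sum: "(\<Sum>S\<in>Pow (rest s). edge_prod G b (rest s) S * (\<Prod>j\<in>alive s. factor s j S)) = ising G b"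
    using inv by (auto simp: elim_inv_def)
  have card: "card (scope s j) \<le> Suc (width N (bag B))" if j: "j \<in> alive s" for j
  proof -
    obtain t where t: "t < N" "scope s j \<subseteq> bag B t" using sc(2)[OF j] by blast
    then have "card (scope s j) \<le> card (bag B t)" by (intro card_mono) (auto simp: bag_def)
    then show ?thesis using card_bag[OF t(1)] by simp
  qed
  show ?thesis
    unfolding wp_Seq
  proof (rule wp_frame[OF wp_find_vertex[OF s(1,2) ne]], goal_cases)
    case (1 t1 s1)
    define v t where "v = wreg s1 5" and "t = wreg s1 6"
    have el: "eliminable (rest s) v t" using 1(1) by (simp add: v_def t_def)
    have v: "v \<in> rest s" "v < n" "v \<notin> alive s" and t: "t < N" "v \<in> bag B t"
      and bags: "\<And>t'. t' < N \<Longrightarrow> v \<in> bag B t' \<Longrightarrow> bag B t' \<inter> rest s \<subseteq> bag B t"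
      using el by (auto simp: eliminable_def rest_def alive_def)
    define U where "U = bag B t \<inter> rest s - {v}"
    define J where "J = {j \<in> alive s. v \<in> scope s j}"
    have cardU: "card U \<le> Suc (width N (bag B))"
    proof -
      have "card U \<le> card (bag B t)" by (rule card_mono) (auto simp: U_def bag_def)
      then show ?thesis using card_bag[OF t(1)] by simp
    qed
    have s1: "inputs s1" "member_upto N s1" "weighted s1" "scope s1 = scope s" "alive s1 = alive s"
      "rest s1 = rest s" "factor s1 = factor s"
      using s 1(2) by (auto simp: frame_def inputs_def member_upto_def weighted_def scope_def alive_def
          rest_def factor_def fun_eq_iff)
    show ?case
    proof (rule wp_frame[OF wp_make_scope[OF s1(1,2)]], goal_cases)
      case (3 t2 s2)
      have sc2: "scope s2 v = U" "wreg s2 7 = 2 ^ card U"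
        "\<And>j. j < n \<Longrightarrow> j \<noteq> v \<Longrightarrow> scope s2 j = scope s j"
        using 3(1) s1 by (auto simp: U_def v_def t_def)
      have s2: "inputs s2" "member_upto N s2" "weighted s2" "alive s2 = alive s" "rest s2 = rest s" "wreg s2 5 = v"
        using s1 3(2) by (auto simp: frame_def inputs_def member_upto_def weighted_def alive_def rest_def v_def)
      have sc_alive: "scope s2 j = scope s j" if "j \<in> alive s" for j
        using sc2(3) that v(3) by (auto simp: alive_def)
      have J2: "J = {j \<in> alive s2. wreg s2 5 \<in> scope s2 j}"
        using s2 sc_alive by (auto simp: J_def)
      have fac2: "factor s2 j = factor s j" if "j < n" "j \<noteq> v" for j
        using 3(2) sc2(3)[OF that] s1(7) s1(4) by (auto simp: frame_def factor_def fun_eq_iff)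
      show ?case
      proof (rule wp_frame[OF wp_make_table[OF s2(1,3), where U = U and J = J]], goal_cases)
        case (9 t3 s3)
        have s3: "inputs s3" "member_upto N s3" "weighted s3" "alive s3 = alive s" "rest s3 = rest s"
          "wreg s3 5 = v" "scope s3 = scope s2"
          using s2 9(2) by (auto simp: frame_def inputs_def member_upto_def weighted_def alive_def
              rest_def scope_def fun_eq_iff)
        have J3: "J = {j \<in> alive s3. wreg s3 5 \<in> scope s3 j}" using J2 s2 s3 by simp
        have v3: "wreg s3 5 \<in> rest s3" using s3 v by simp
        show ?case
        proof (rule wp_frame[OF wp_mark[OF s3(1) v3 J3]], goal_cases)
          case (1 t4 s4)
          have s4: "inputs s4" "member_upto N s4" "weighted s4" "rest s4 = rest s - {v}"
            "alive s4 = insert v (alive s - J)" "scope s4 = scope s2" "factor s4 = factor s3"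
            using s3 1 by (auto simp: frame_def inputs_def member_upto_def weighted_def
                scope_def factor_def fun_eq_iff)
          \<comment> \<open>\<open>make_scope\<close> changes row \<open>v\<close> of the scopes and
            hence only the factor read at \<open>v\<close>, which is not alive and so not in
            \<open>J\<close>.\<close>
          have msg: "message G b v U J (factor s2) S = message G b v U J (factor s) S" for S
          proof (rule message_cong)
            fix j assume "j \<in> J"
            then have "j < n" "j \<noteq> v" using v(3) by (auto simp: J_def alive_def)
            then show "factor s2 j S = factor s j S" using fac2 by simp
          qed
          \<comment> \<open>The bag containing this scope contains \<open>v\<close>, so
            eliminability pushes its remaining vertices into \<open>bag B t\<close>. The obligation
            for edges below is met in the same way through \<open>bag_of_edge\<close>.\<close>
          have scJ: "scope s j \<subseteq> insert v U" if j: "j \<in> alive s" "v \<in> scope s j" for j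
          proof -
            obtain t' where "t' < N" "scope s j \<subseteq> bag B t'" using sc(2)[OF j(1)] by blast
            then have "scope s j \<subseteq> bag B t" using bags[of t'] sc(1)[OF j(1)] j(2) by blast
            then show ?thesis using sc(1)[OF j(1)] by (auto simp: U_def)
          qed
          have "(\<Sum>S\<in>Pow (rest s). edge_prod G b (rest s) S * (\<Prod>j\<in>alive s. factor s j S)) =
            (\<Sum>S\<in>Pow (rest s - {v}). edge_prod G b (rest s - {v}) S *
              (\<Prod>j\<in>insert v (alive s - J). factor s4 j S))"
          proof (rule eliminate_vertex[where U = U and D = "scope s"])
            show "finite (rest s)" "finite (alive s)" by (simp_all add: rest_def alive_def)
            show "v \<in> rest s" "v \<notin> alive s" by fact+
            show "U \<subseteq> rest s - {v}" by (auto simp: U_def)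
            show "J = {j \<in> alive s. v \<in> scope s j}" by (rule J_def)
            show "factor s j S = factor s j (S \<inter> scope s j)" for j S
              using code_local by (metis factor_def)
            show "factor s4 v S = message G b v U J (factor s) (S \<inter> U) +
                message G b v U J (factor s) (insert v (S \<inter> U))" for S
              using 9(1) s4(7) s2(6) msg by simp
            show "factor s4 j S = factor s j S" if "j \<in> alive s - J" for j S
            proof -
              have "j < n" "j \<noteq> v" using that v(3) by (auto simp: alive_def)
              then show ?thesis using 9(1) s4(7) s2(6) fac2 by simp
            qed
            show "{fst (ends G ! e), snd (ends G ! e)} \<subseteq> insert v U"
              if e: "e \<in> edges G" "fst (ends G ! e) \<in> rest s" "snd (ends G ! e) \<in> rest s"
                "v \<in> {fst (ends G ! e), snd (ends G ! e)}" for e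
            proof -
              obtain t' where t': "t' < N" "fst (ends G ! e) \<in> bag B t'" "snd (ends G ! e) \<in> bag B t'"
                using bag_of_edge[OF e(1)] by blast
              then have "bag B t' \<inter> rest s \<subseteq> bag B t" using bags[of t'] e(4) by auto
              then show ?thesis using e t' by (auto simp: U_def)
            qed
          qed (use scJ in auto)
          moreover have "scope s4 j \<subseteq> rest s4 \<and> (\<exists>t<N. scope s4 j \<subseteq> bag B t)" if "j \<in> alive s4" for j
          proof (cases "j = v")
            case True
            then show ?thesis using s4 sc2(1) t by (auto simp: U_def)
          next
            case False
            then have j: "j \<in> alive s" "v \<notin> scope s j" using that s4(5) by (auto simp: J_def)
            then show ?thesis using s4(4,6) sc_alive[OF j(1)] sc(1)[OF j(1)] sc(2)[OF j(1)] by auto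
          qed
          ultimately have "elim_inv s4" using s4 sum by (simp add: elim_inv_def)
          moreover have "card (rest s4) = card (rest s) - 1" using s4(4) v(1) by simp
          ultimately show ?case
            using 1(1) 9(1) 3(1) \<open>t1 \<le> _ \<and> _\<close> by (simp add: algebra_simps)
        qed
      qed (use s2 sc2 v card sc_alive J2 cardU in \<open>auto simp: U_def\<close>)
    qed (use v t in \<open>auto simp: v_def t_def\<close>)
  qed
qed

lemma elim_inv_wreg4 [simp]:
  "elim_inv (s\<lparr>wreg := (wreg s)(4 := k)\<rparr>) = elim_inv s" "rest (s\<lparr>wreg := (wreg s)(4 := k)\<rparr>) = rest s"
  by (simp_all add: elim_inv_def inputs_def member_upto_def weighted_def scope_def alive_def
      rest_def factor_def)

lemma ising_eq_edge_prod: "(\<Sum>S\<in>Pow (verts G). edge_prod G b (verts G) S) = ising G b"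
proof -
  have "{e \<in> edges G. fst (ends G ! e) \<in> verts G \<and> snd (ends G ! e) \<in> verts G} = edges G"
    using ends_in_verts[OF wf] by auto
  then show ?thesis by (simp add: edge_prod_def ising_def)
qed

abbreviation "step_time \<equiv> (n * (N * (N * (n * 60 + 50) + 100) + 50) + n * 140 + 60) +
  bound * (n * (n * 120 + 440) + 300)"

lemma wp_eliminate:
  assumes s: "inputs s" "member_upto N s" "weighted s" and zero: "warr s 7 = (\<lambda>_. 0)"
  shows "wp W eliminate s (\<lambda>t s'. t \<le> n * (step_time + 20) + 10 \<and> elim_inv s' \<and> rest s' = {})"
  unfolding eliminate_def
proof (rule wp_For[where n = n and T = step_time and I = "\<lambda>i s'. elim_inv s' \<and> card (rest s') = n - i"],
    goal_cases)
  case 1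
  show ?case by (rule n_word)
next
  case (3 i s')
  then show ?case by (simp add: elim_inv_def inputs_def)
next
  case 4
  have "rest s = verts G" "alive s = {}" using zero by (auto simp: rest_def alive_def verts_def)
  then have "elim_inv s" "card (rest s) = n"
    using s ising_eq_edge_prod by (simp_all add: elim_inv_def) (simp add: verts_def)
  then show ?case by simp
next
  case (5 i s')
  then have "rest s' \<noteq> {}" by auto
  then show ?case
    by (rule wp_mono[OF wp_eliminate_step, rotated]) (use 5 in auto)
next
  case (6 t s')
  have "finite (rest s')" by (simp add: rest_def)
  then show ?case using 6 by (simp add: algebra_simps)
qed simp

lemma wp_finish:
  assumes inv: "elim_inv s" and none: "rest s = {}"
    and lab: "card {v. v < n \<and> warr s 10 v = v} = num_comps G (edges G)"
  shows "wp W finish s (\<lambda>t s'. t \<le> n * 80 + 20 \<and>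
    nreg s' 0 = ising G b / ((a - 1) ^ num_comps G (edges G) * (b - 1) ^ n))"
proof -
  have s: "inputs s" using inv by (simp add: elim_inv_def)
  have "factor s j {} = narr s 1 j" if "j \<in> alive s" for j
  proof -
    have "scope s j = {}" using inv none that by (auto simp: elim_inv_def)
    then show ?thesis by (simp add: factor_def code_def)
  qed
  then have Z: "(\<Prod>j\<in>alive s. narr s 1 j) = ising G b"
    using inv none by (simp add: elim_inv_def edge_prod_def)
  show ?thesis
    unfolding finish_def wp_Seq wp_atomic
  proof (rule wp_For[where n = n and T = 50 and I = "\<lambda>i s'. nreg s' 2 =
      (\<Prod>j\<in>alive s \<inter> {..<i}. narr s 1 j) /
        ((a - 1) ^ card {v. v < i \<and> warr s 10 v = v} * (b - 1) ^ i)"], goal_cases)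
    case (5 i s')
    have w: "wreg s' 4 = i" "warr s' 7 = warr s 7" "warr s' 10 = warr s 10" "narr s' = narr s"
      "nreg s' 0 = a" "nreg s' 1 = b"
      using 5(3,4) s by (auto simp: frame_def inputs_def fun_eq_iff)
    have "i \<in> alive s \<longleftrightarrow> warr s 7 i = 1" using 5(1) by (simp add: alive_def)
    then show ?case using 5(2) w
      by (auto simp: prod_Int_lessThan_Suc card_less_Suc_filter mult_ac)
  next
    case (6 t s')
    have "alive s \<inter> {..<n} = alive s" by (auto simp: alive_def)
    then show ?case using 6(1,2) Z lab by simp
  qed (use n_word s in \<open>auto simp: frame_def inputs_def\<close>)
qed

section \<open>Total running time\<close>

lemma time_bound:
  assumes "t \<le> (n * n * 100 + m * 100 + 200) + (m * (n * 30 + 50) + n * 20 + 20) +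
    (N * (sz * 30 + 30) + 10) + (n * (step_time + 20) + 10) + (n * 80 + 20)"
  shows "t \<le> 10000 * (2 ^ width N (bag B) * n ^ 5 + sz ^ 5)"
proof -
  define z where "z = sz"
  define p where "p = (2::nat) ^ width N (bag B)"
  have le: "n \<le> z" "m \<le> z" "N \<le> z" "1 \<le> z" using sz_ge by (auto simp: z_def)
  have pow: "z ^ i \<le> z ^ j" if "i \<le> j" for i j using that le(4) by (rule power_increasing)
  have up: "x * y \<le> c * z ^ Suc k" if "x \<le> z" "y \<le> c * z ^ k" for x y c k
    using mult_mono[OF that] by (simp add: mult_ac)
  have one: "1 \<le> z ^ k" for k using le(4) by simp
  have z1: "z \<le> z ^ Suc k" for k using pow[of 1 "Suc k"] by simp
  have a1: "n * n \<le> 1 * z ^ Suc 1" using le by (intro up) auto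
  have a2: "m * (n * 30 + 50) \<le> 80 * z ^ Suc 1" using le by (intro up) auto
  have a3: "N * (z * 30 + 30) \<le> 60 * z ^ Suc 1" using le by (intro up) auto
  have a4: "N * (n * 60 + 50) \<le> 110 * z ^ Suc 1" using le by (intro up) auto
  have a5: "N * (N * (n * 60 + 50) + 100) \<le> 210 * z ^ Suc (Suc 1)"
    using a4 one[of "Suc 1"] le by (intro up) linarith+
  have a6: "n * (N * (N * (n * 60 + 50) + 100) + 50) \<le> 260 * z ^ Suc (Suc (Suc 1))"
    using a5 one[of "Suc (Suc 1)"] le by (intro up) linarith+
  \<comment> \<open>This term fixes the exponent 5: \<open>n\<close> rounds, each with
    \<open>n\<close> candidate vertices, \<open>N * N\<close> pairs of bags and \<open>n\<close>
    vertex tests per pair.\<close>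
  have a7: "n * (n * (N * (N * (n * 60 + 50) + 100) + 50) + n * 140 + 80) \<le> 480 * z ^ Suc (Suc (Suc (Suc 1)))"
    using a6 one[of "Suc (Suc (Suc 1))"] z1[of "Suc (Suc 1)"] le by (intro up) linarith+
  \<comment> \<open>Filling the tables contributes only a cubic power of \<open>n\<close>; it is
    raised to 5 so that both terms share one exponent. For \<open>n = 0\<close> the left side
    vanishes, which matters because the constants are absorbed into \<open>n ^ 4\<close>.\<close>
  have b1: "n * (2 * p * (n * (n * 120 + 440) + 300)) \<le> 2000 * (p * n ^ 5)"
  proof (cases "n = 0")
    case False
    then have n1: "1 \<le> n" by simp
    have "n ^ 2 \<le> n ^ 4" "n ^ 1 \<le> n ^ 4" "n ^ 0 \<le> n ^ 4" using n1 by (intro power_increasing; simp)+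
    then have "n * (n * 120 + 440) + 300 \<le> 1000 * n ^ 4"
      by (simp add: algebra_simps power2_eq_square)
    then have "(n * (2 * p)) * (n * (n * 120 + 440) + 300) \<le> (n * (2 * p)) * (1000 * n ^ 4)"
      by (intro mult_left_mono) auto
    also have "\<dots> = 2000 * (p * (n * n ^ 4))" by simp
    also have "n * n ^ 4 = n ^ 5" by (simp flip: power_Suc)
    finally show ?thesis by (simp only: mult.assoc)
  qed simp
  have st: "n * (step_time + 20) = n * (n * (N * (N * (n * 60 + 50) + 100) + 50) + n * 140 + 80) +
      n * (2 * p * (n * (n * 120 + 440) + 300))"
    unfolding p_def power_Suc by (simp add: algebra_simps)
  have z5: "z ^ Suc 1 \<le> z ^ 5" "z ^ Suc (Suc (Suc (Suc 1))) = z ^ 5" "z \<le> z ^ 5" "1 \<le> z ^ 5"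
    using pow[of "Suc 1" 5] pow[of 1 5] one[of 5] by (auto simp: eval_nat_numeral)
  \<comment> \<open>Named products become atoms for linear arithmetic.\<close>
  define q1 q2 q3 q4 where "q1 = n * n" and "q2 = m * (n * 30 + 50)" and "q3 = N * (sz * 30 + 30)"
    and "q4 = n * (step_time + 20)"
  have "q1 \<le> z ^ 5" "q2 \<le> 80 * z ^ 5" "q3 \<le> 60 * z ^ 5" "q4 \<le> 480 * z ^ 5 + 2000 * (p * n ^ 5)"
    using a1 a2 a3 a7 b1 z5 unfolding q1_def q2_def q3_def q4_def st z_def by linarith+
  then have "t \<le> 2000 * (p * n ^ 5) + 2000 * z ^ 5"
    using assms[folded q1_def q2_def q3_def q4_def] z5(3,4) le by linarith
  then show ?thesis unfolding z_def p_def by simp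
qed

lemma wp_tutte_program:
  assumes ab: "(a - 1) * (b - 1) = 2"
  shows "wp W tutte_program (init_state G F B a b) (\<lambda>t s'.
    t \<le> 10000 * (2 ^ width N (bag B) * n ^ 5 + sz ^ 5) \<and> result s' = tutte G a b)"
proof -
  define s where "s = init_state G F B a b"
  have s: "inputs s" "warr s 6 = (\<lambda>_. 0)" "warr s 7 = (\<lambda>_. 0)"
    by (auto simp: s_def inputs_def init_state_def array_of_def eval_nat_numeral fun_eq_iff)
  show ?thesis
    unfolding tutte_program_def wp_Seq s_def[symmetric]
  proof (rule wp_frame[OF wp_weights[OF s(1)]], goal_cases)
    case (1 t1 s1)
    have s1: "inputs s1" "warr s1 6 = (\<lambda>_. 0)" "warr s1 7 = (\<lambda>_. 0)" "weighted s1"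
      using s 1 by (auto simp: frame_def inputs_def weighted_def)
    show ?case
    proof (rule wp_frame[OF wp_labels[OF s1(1)]], goal_cases)
      case (1 t2 s2)
      have s2: "inputs s2" "warr s2 6 = (\<lambda>_. 0)" "warr s2 7 = (\<lambda>_. 0)" "weighted s2"
        using s1 1 by (auto simp: frame_def inputs_def weighted_def)
      note lab = 1(1)
      show ?case
      proof (rule wp_frame[OF wp_membership[OF s2(1,2)]], goal_cases)
        case (1 t3 s3)
        have s3: "inputs s3" "member_upto N s3" "weighted s3" "warr s3 7 = (\<lambda>_. 0)" "warr s3 10 = warr s2 10"
          using s2 1 by (auto simp: frame_def inputs_def weighted_def)
        show ?case
        proof (rule wp_frame[OF wp_eliminate[OF s3(1-4)]], goal_cases)
          case (1 t4 s4)
          have s4: "warr s4 10 = warr s2 10" using s3(5) 1(2) by (simp add: frame_def)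
          show ?case
          proof (rule wp_mono[OF wp_finish], goal_cases)
            case (4 t5 s5)
            have "t1 + (t2 + (t3 + (t4 + t5))) \<le> 10000 * (2 ^ width N (bag B) * n ^ 5 + sz ^ 5)"
              by (rule time_bound)
                (use \<open>t1 \<le> _ \<and> _\<close> \<open>t2 \<le> _ \<and> _\<close> \<open>t3 \<le> _ \<and> _\<close> \<open>t4 \<le> _ \<and> _\<close> \<open>t5 \<le> _ \<and> _\<close> in linarith)
            then show ?case using 4 tutte_eq_ising[OF wf ab] by (simp add: result_def)
          qed (use 1 lab s4 in auto)
        qed
      qed
    qed
  qed
qed

end

theorem theorem37:
  shows "\<exists>(P :: com) (C :: nat) (c :: nat).
    \<forall>(G :: mgraph) (F :: (nat \<times> nat) list) (B :: nat list list)
      (a :: 'a::field_char_0) (b :: 'a) (W :: nat).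
      wf_mgraph G \<longrightarrow>
      encodes_tree_decomposition G F B \<longrightarrow>
      width (length B) (bag B) = treewidth G \<longrightarrow>
      (a - 1) * (b - 1) = 2 \<longrightarrow>
      C * (2 ^ treewidth G * nverts G ^ c + input_size G F B ^ c) \<le> 2 ^ W \<longrightarrow>
      (\<exists>t s. exec W P (init_state G F B a b) t s \<and>
             result s = tutte G a b \<and>
             t \<le> C * (2 ^ treewidth G * nverts G ^ c + input_size G F B ^ c))"
\<comment> \<open>The constants are those of \<open>time_bound\<close>, and 10000 also covers the
  100 asked for by the word bound of the locale. Treewidth enters only here, replacing the width of
  the given decomposition.\<close>
proof (rule exI[of _ tutte_program], rule exI[of _ 10000], rule exI[of _ 5], intro allI impI)
  fix G F B W and a b :: 'a
  assume wf: "wf_mgraph G" and td: "encodes_tree_decomposition G F B"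
    and tw: "width (length B) (bag B) = treewidth G" and ab: "(a - 1) * (b - 1) = 2"
    and W: "10000 * (2 ^ treewidth G * nverts G ^ 5 + input_size G F B ^ 5) \<le> (2::nat) ^ W"
  interpret tutte_input G F B a b W
    using wf td W by unfold_locales (simp_all add: tw)
  show "\<exists>t s. exec W tutte_program (init_state G F B a b) t s \<and> result s = tutte G a b \<and>
      t \<le> 10000 * (2 ^ treewidth G * nverts G ^ 5 + input_size G F B ^ 5)"
    using wp_tutte_program[OF ab] unfolding wp_def tw by blast
qed

end
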